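(* Consider the problem $\min_{x\in\mathbb{R}^n}\frac{\|x\|_1}{\|x\|}$ subject to $q(x)\le0$, where $q=P_1-P_2$ with $P_1:\mathbb{R}^n\to\mathbb{R}$ continuously differentiable with Lipschitz continuous gradient, $P_2:\mathbb{R}^n\to\mathbb{R}$ convex continuous, $\{x:q(x)\le0\}\neq\emptyset$ and $q(0)>0$. Suppose that the GMFCQ holds at every point of $\{x:q(x)\le0\}$. Let $\{(x^t,\zeta^t,\bar l_t)\}$ be the sequence generated by the algorithm MBA$_{\ell_1/\ell_2}$ (described in the context), and let $\lambda_t$ be a Lagrange multiplier of the subproblem (S) with $l_t=\bar l_t$. Suppose in addition that $\{x^t\}$ is bounded. Then the following statements hold: (i) $\lim_{t\to\infty}\|x^{t+1}-x^t\|=0$. (ii) The sequences $\{\lambda_t\}$ and $\{\zeta^t\}$ are bounded. (iii) Let $\bar x$ be an accumulation point of $\{x^t\}$. Then $\bar x$ is a Clarke critical point of the problem. If $q$ is also regular at $\bar x$, then $\bar x$ is a stationary point of the problem.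
   Context: Algorithm MBA$_{\ell_1/\ell_2}$. Step 0: choose $x^0$ with $q(x^0)\le0$, $\alpha>0$ and $0<l_{\min}<l_{\max}$; set $\omega_0=\|x^0\|_1/\|x^0\|$, $t=0$. Step 1: choose $l_t^0\in[l_{\min},l_{\max}]$ arbitrarily, set $l_t=l_t^0$, and choose $\zeta^t\in\partial P_2(x^t)$. (1a) Let $\widetilde x$ be the minimizer of the subproblem $$\text{(S)}\quad \min_x\ \|x\|_1-\frac{\omega_t}{\|x^t\|}\langle x,x^t\rangle+\frac\alpha2\|x-x^t\|^2\ \ \text{s.t.}\ \ q(x^t)+\langle\nabla P_1(x^t)-\zeta^t,x-x^t\rangle+\frac{l_t}2\|x-x^t\|^2\le0.$$ (1b) If $q(\widetilde x)\le0$, go to Step 2; else replace $l_t$ by $2l_t$ and go to (1a). Step 2: set $x^{t+1}=\widetilde x$, $\omega_{t+1}=\|x^{t+1}\|_1/\|x^{t+1}\|$, $\bar l_t:=l_t$; replace $t$ by $t+1$ and go to Step 1. A Lagrange multiplier of (S) is a Lagrange multiplier $\lambda_t\ge0$ for its single inequality constraint. Subdifferentials: for proper closed $h$ and $\bar x\in\mathrm{dom}\,h$, $\widehat\partial h(\bar x)=\{v:\liminf_{x\to\bar x,x\ne\bar x}\frac{h(x)-h(\bar x)-\langle v,x-\bar x\rangle}{\|x-\bar x\|}\ge0\}$; the limiting subdifferential is $\partial h(\bar x)=\{v:\exists\,x^k\to\bar x,\ h(x^k)\to h(\bar x),\ v^k\in\widehat\partial h(x^k),\ v^k\to v\}$ (the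 classical subdifferential when $h$ is convex). For locally Lipschitz $h$, the Clarke subdifferential is $\partial^\circ h(\bar x)=\{v:\limsup_{x\to\bar x,\tau\downarrow0}\frac{h(x+\tau w)-h(x)}{\tau}\ge\langle v,w\rangle\ \forall w\in\mathbb{R}^n\}$. A nonempty closed set $C$ is regular at $x\in C$ if $\partial\delta_C(x)=\widehat\partial\delta_C(x)$, with $\delta_C$ the indicator function ($0$ on $C$, $\infty$ off $C$); a function is regular at a point if its epigraph is regular at the corresponding point of its graph. GMFCQ holds at $x^*$ with $q(x^* )\le0$ if: $q(x^* )=0$ implies $0\notin\partial^\circ q(x^* )$. A point $\bar x$ with $q(\bar x)\le0$ is a stationary point of the problem if $0\in\partial\big(\frac{\|\cdot\|_1}{\|\cdot\|}+\delta_{\{q\le0\}}\big)(\bar x)$; it is a Clarke critical point if there is $\bar\lambda\ge0$ with $0\in\partial\frac{\|\cdot\|_1}{\|\cdot\|}(\bar x)+\bar\lambda\,\partial^\circ q(\bar x)$ and $\bar\lambda q(\bar x)=0$. *)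

theory Defs
  imports "HOL-Analysis.Analysis"
begin

section \<open>Subdifferentials and regularity\<close>

definition frechet_subdiff :: "('a::euclidean_space \<Rightarrow> ereal) \<Rightarrow> 'a \<Rightarrow> 'a set" where
  "frechet_subdiff h x =
    {v. \<bar>h x\<bar> \<noteq> \<infinity> \<and>
        Liminf (at x) (\<lambda>y. (h y - h x - ereal (v \<bullet> (y - x))) / ereal (norm (y - x))) \<ge> 0}"

definition limiting_subdiff :: "('a::euclidean_space \<Rightarrow> ereal) \<Rightarrow> 'a \<Rightarrow> 'a set" where
  "limiting_subdiff h x =
    {v. \<bar>h x\<bar> \<noteq> \<infinity> \<and>
        (\<exists>X V. X \<longlonglongrightarrow> x \<and> (\<lambda>k. h (X k)) \<longlonglongrightarrow> h x \<and>
               (\<forall>k. V k \<in> frechet_subdiff h (X k)) \<and> V \<longlonglongrightarrow> v)}"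

text \<open>The base point \<open>y\<close> of the difference quotient may equal \<open>x\<close>, hence \<open>nhds\<close> and not \<open>at\<close>.\<close>

definition clarke_subdiff :: "('a::euclidean_space \<Rightarrow> real) \<Rightarrow> 'a \<Rightarrow> 'a set" where
  "clarke_subdiff h x =
    {v. \<forall>w. Limsup (nhds x \<times>\<^sub>F at_right 0)
               (\<lambda>(y, \<tau>). ereal ((h (y + \<tau> *\<^sub>R w) - h y) / \<tau>)) \<ge> ereal (v \<bullet> w)}"

definition indicator_ext :: "'a set \<Rightarrow> 'a \<Rightarrow> ereal" where
  "indicator_ext C x = (if x \<in> C then 0 else \<infinity>)"

definition regular_set_at :: "'a::euclidean_space set \<Rightarrow> 'a \<Rightarrow> bool" where
  "regular_set_at C x \<longleftrightarrow> closed C \<and> x \<in> C \<and>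
     limiting_subdiff (indicator_ext C) x = frechet_subdiff (indicator_ext C) x"

definition regular_at :: "('a::euclidean_space \<Rightarrow> real) \<Rightarrow> 'a \<Rightarrow> bool" where
  "regular_at h x \<longleftrightarrow> regular_set_at (epigraph UNIV h) (x, h x)"

section \<open>The constrained problem\<close>

definition l1norm :: "real ^ 'n \<Rightarrow> real" where
  "l1norm x = (\<Sum>i\<in>UNIV. \<bar>x $ i\<bar>)"

text \<open>At the origin, which is infeasible when \<open>q 0 > 0\<close>, this quotient is \<open>0 / 0 = 0\<close>.\<close>

definition l1l2 :: "real ^ 'n \<Rightarrow> real" where
  "l1l2 x = l1norm x / norm x"

definition GMFCQ_at :: "('a::euclidean_space \<Rightarrow> real) \<Rightarrow> 'a \<Rightarrow> bool" where
  "GMFCQ_at q x \<longleftrightarrow> (q x = 0 \<longrightarrow> 0 \<notin> clarke_subdiff q x)"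

definition stationary_point :: "(real ^ 'n \<Rightarrow> real) \<Rightarrow> real ^ 'n \<Rightarrow> bool" where
  "stationary_point q x \<longleftrightarrow> q x \<le> 0 \<and>
     0 \<in> limiting_subdiff (\<lambda>y. ereal (l1l2 y) + indicator_ext {z. q z \<le> 0} y) x"

definition clarke_critical_point :: "(real ^ 'n \<Rightarrow> real) \<Rightarrow> real ^ 'n \<Rightarrow> bool" where
  "clarke_critical_point q x \<longleftrightarrow> q x \<le> 0 \<and>
     (\<exists>\<mu>\<ge>0. (\<exists>u \<in> limiting_subdiff (\<lambda>y. ereal (l1l2 y)) x. \<exists>v \<in> clarke_subdiff q x.
                 0 = u + \<mu> *\<^sub>R v) \<and> \<mu> * q x = 0)"

section \<open>The algorithm\<close>

text \<open>Objective and constraint function of the subproblem at the current iterate \<open>xt\<close>: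
  \<open>w\<close> is the current ratio, \<open>g\<close> the gradient of the smooth part of \<open>q\<close> at \<open>xt\<close>, and \<open>z\<close> the
  chosen subgradient of its concave part.\<close>

definition sub_obj :: "real \<Rightarrow> real \<Rightarrow> real ^ 'n \<Rightarrow> real ^ 'n \<Rightarrow> real" where
  "sub_obj \<alpha> w xt x =
     l1norm x - (w / norm xt) * (x \<bullet> xt) + \<alpha> / 2 * (norm (x - xt))\<^sup>2"

definition sub_con ::
  "(real ^ 'n \<Rightarrow> real) \<Rightarrow> real ^ 'n \<Rightarrow> real ^ 'n \<Rightarrow> real \<Rightarrow> real ^ 'n \<Rightarrow> real ^ 'n \<Rightarrow> real" where
  "sub_con q g z l xt x = q xt + (g - z) \<bullet> (x - xt) + l / 2 * (norm (x - xt))\<^sup>2"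

text \<open>\<open>lag\<close> is a Lagrange multiplier, at the solution \<open>x\<close>, of the convex program of minimizing \<open>f\<close>
  subject to \<open>c \<le> 0\<close>: the KKT conditions hold. For convex \<open>f\<close> and \<open>c\<close> the subdifferential below is
  the classical one, so that \<open>x\<close> minimizes the Lagrangian.\<close>

definition lagrange_multiplier ::
  "('a::euclidean_space \<Rightarrow> real) \<Rightarrow> ('a \<Rightarrow> real) \<Rightarrow> 'a \<Rightarrow> real \<Rightarrow> bool" where
  "lagrange_multiplier f c x lag \<longleftrightarrow> 0 \<le> lag \<and> c x \<le> 0 \<and> lag * c x = 0 \<and>
     0 \<in> limiting_subdiff (\<lambda>y. ereal (f y + lag * c y)) x"

text \<open>\<open>(x, \<zeta>, lbar)\<close> is an infinite run of the algorithm. In iteration \<open>t\<close>, \<open>l0\<close> is the freely chosen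
  initial value, \<open>y j\<close> is the trial point computed after \<open>j\<close> doublings, and \<open>k\<close> is the number of
  doublings after which the trial point is accepted.\<close>

definition MBA_run ::
  "(real ^ 'n \<Rightarrow> real) \<Rightarrow> (real ^ 'n \<Rightarrow> real ^ 'n) \<Rightarrow> (real ^ 'n \<Rightarrow> real) \<Rightarrow>
   real \<Rightarrow> real \<Rightarrow> real \<Rightarrow>
   (nat \<Rightarrow> real ^ 'n) \<Rightarrow> (nat \<Rightarrow> real ^ 'n) \<Rightarrow> (nat \<Rightarrow> real) \<Rightarrow> bool" where
  "MBA_run q gradP1 P2 \<alpha> lmin lmax x \<zeta> lbar \<longleftrightarrow>
     q (x 0) \<le> 0 \<and> 0 < \<alpha> \<and> 0 < lmin \<and> lmin < lmax \<and>
     (\<forall>t. \<zeta> t \<in> limiting_subdiff (\<lambda>y. ereal (P2 y)) (x t) \<and>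
          (\<exists>l0 k y. lmin \<le> l0 \<and> l0 \<le> lmax \<and>
             (\<forall>j\<le>k. is_arg_min (sub_obj \<alpha> (l1l2 (x t)) (x t))
                       (\<lambda>u. sub_con q (gradP1 (x t)) (\<zeta> t) (2 ^ j * l0) (x t) u \<le> 0) (y j)) \<and>
             (\<forall>j<k. q (y j) > 0) \<and> q (y k) \<le> 0 \<and>
             x (Suc t) = y k \<and> lbar t = 2 ^ k * l0))"

end

theory Submission
  imports Defs
begin

text \<open>The proof rests on one inequality. With \<open>v = gradP1 a - z\<close>, where \<open>z\<close> is a subgradient of
  \<open>P2\<close> at \<open>a\<close> and \<open>L\<close> is a Lipschitz constant of \<open>gradP1\<close>,
  \<open>q u \<le> q a + v \<bullet> (u - a) + L / 2 * (norm (u - a))\<^sup>2\<close> for all \<open>u\<close>: the Lipschitz gradient bounds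
  \<open>P1\<close> from above and convexity bounds \<open>P2\<close> from below. Call \<open>v\<close> an upper support of \<open>q\<close> at \<open>a\<close>.
  It has four consequences. A trial point computed with \<open>l \<ge> L\<close> is accepted, so the accepted \<open>lbar\<close>
  stay bounded. The estimate survives limits in \<open>a\<close> and \<open>z\<close>. Every upper support is a Clarke
  subgradient (lemma \<open>upper_support_imp_clarke\<close>). And if \<open>q\<close> is regular at \<open>a\<close>, then \<open>(v, -1)\<close> is
  a Frechet normal of the epigraph there, and if also \<open>q a = 0\<close>, then \<open>v\<close> is normal to the
  sublevel set (lemma \<open>regular_upper_support_normal_sublevel\<close>).

  The current iterate is feasible for its own subproblem, so comparing objective values gives
  \<open>l1l2 (x (Suc t)) + \<alpha> / (2 * norm (x (Suc t))) * (norm (x (Suc t) - x t))\<^sup>2 \<le> l1l2 (x t)\<close>. For bounded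
  iterates the squared steps are dominated by the decrements of a convergent sequence, and they
  vanish. The subgradients \<open>\<zeta> t\<close> are bounded because \<open>P2\<close> is bounded on bounded sets.

  The Lagrangian of the subproblem is convex, so the multiplier condition says that the new iterate
  is its global minimizer. In this form it passes to the limit without any calculus of
  subdifferentials, even after rescaling by factors \<open>a k\<close> (lemma \<open>limiting_optimality\<close>). The factors
  \<open>a k = 1 / lag (r k)\<close> along a sequence of multipliers that tends to infinity leave only the
  constraint term, which forces \<open>q xbar = 0\<close> and \<open>v = 0\<close>: a zero Clarke subgradient, excluded by
  the constraint qualification. So the multipliers are bounded. The factors \<open>a k = 1\<close> show that
  \<open>xbar\<close> minimizes the limiting Lagrangian. Replacing the linear function \<open>(u \<bullet> xbar) / norm xbar\<close>
  by \<open>norm u\<close> costs only a quadratic error, so dividing by \<open>norm u\<close> turns this into a proximal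
  subgradient \<open>- \<mu> v\<close> of \<open>l1l2\<close> at \<open>xbar\<close> (lemma \<open>l1l2_proximal_subgradient\<close>). It cancels \<open>\<mu> v\<close>,
  which gives Clarke criticality, and together with normality of \<open>v\<close> it gives stationarity in the
  regular case.\<close>

section \<open>Subgradients as one-sided estimates\<close>

text \<open>All later arguments use Frechet subgradients through this estimate, which involves no extended
  real quotients: the value \<open>\<infinity>\<close> of \<open>h y\<close> makes it trivial.\<close>

lemma frechet_subdiff_iff:
  fixes h :: "'a::euclidean_space \<Rightarrow> ereal"
  assumes hx: "h x = ereal r"
  shows "v \<in> frechet_subdiff h x \<longleftrightarrow>
    (\<forall>e>0. \<forall>\<^sub>F y in at x. ereal (r + v \<bullet> (y - x) - e * norm (y - x)) \<le> h y)"
proof -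
  define Q where "Q y = (h y - h x - ereal (v \<bullet> (y - x))) / ereal (norm (y - x))" for y
  have Q_iff: "ereal (- e) \<le> Q y \<longleftrightarrow> ereal (r + v \<bullet> (y - x) - e * norm (y - x)) \<le> h y"
    if "y \<noteq> x" for e y
  proof -
    have pos: "norm (y - x) > 0"
      using that by simp
    show ?thesis
    proof (cases "h y")
      case (real s)
      have "- e \<le> (s - r - v \<bullet> (y - x)) / norm (y - x) \<longleftrightarrow>
          - e * norm (y - x) \<le> s - r - v \<bullet> (y - x)"
        using pos by (rule pos_le_divide_eq)
      then show ?thesis
        using real hx pos by (auto simp: Q_def)
    next
      case PInf
      then show ?thesis
        using hx pos by (simp add: Q_def)
    next
      case MInf
      then show ?thesis
        using hx pos by (simp add: Q_def)
    qed
  qed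
  have "v \<in> frechet_subdiff h x \<longleftrightarrow> 0 \<le> Liminf (at x) Q"
    by (simp add: frechet_subdiff_def hx Q_def[abs_def])
  also have "\<dots> \<longleftrightarrow> (\<forall>c<0. \<forall>\<^sub>F y in at x. c < Q y)"
    by (rule le_Liminf_iff)
  also have "\<dots> \<longleftrightarrow> (\<forall>e>0. \<forall>\<^sub>F y in at x. ereal (- e) \<le> Q y)"
  proof (intro iffI allI impI)
    fix e :: real
    assume "\<forall>c<0. \<forall>\<^sub>F y in at x. c < Q y" "e > 0"
    then have "\<forall>\<^sub>F y in at x. ereal (- e) < Q y"
      by simp
    then show "\<forall>\<^sub>F y in at x. ereal (- e) \<le> Q y"
      by (rule eventually_mono) simp
  next
    fix c :: ereal
    assume *: "\<forall>e>0. \<forall>\<^sub>F y in at x. ereal (- e) \<le> Q y" and "c < 0"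
    obtain e where e: "e > 0" "c < ereal (- e)"
    proof (cases c)
      case (real b)
      then show ?thesis
        using \<open>c < 0\<close> that[of "- b / 2"] by simp
    next
      case PInf
      then show ?thesis
        using \<open>c < 0\<close> by simp
    next
      case MInf
      then show ?thesis
        using that[of 1] by simp
    qed
    from * e(1) have "\<forall>\<^sub>F y in at x. ereal (- e) \<le> Q y"
      by blast
    then show "\<forall>\<^sub>F y in at x. c < Q y"
      by (rule eventually_mono) (use e(2) in order)
  qed
  also have "\<dots> \<longleftrightarrow>
      (\<forall>e>0. \<forall>\<^sub>F y in at x. ereal (r + v \<bullet> (y - x) - e * norm (y - x)) \<le> h y)"
  proof -
    have "(\<forall>\<^sub>F y in at x. ereal (- e) \<le> Q y) \<longleftrightarrow>
        (\<forall>\<^sub>F y in at x. ereal (r + v \<bullet> (y - x) - e * norm (y - x)) \<le> h y)" for e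
      by (rule eventually_cong) (auto simp: eventually_at_filter Q_iff)
    then show ?thesis
      by simp
  qed
  finally show ?thesis .
qed

lemma eventually_quadratic_le_linear:
  fixes x :: "'a::euclidean_space"
  assumes "e > 0"
  shows "\<forall>\<^sub>F y in at x. C * (norm (y - x))\<^sup>2 \<le> e * norm (y - x)"
proof -
  have "((\<lambda>y. C * norm (y - x)) \<longlongrightarrow> C * norm (x - x)) (at x)"
    by (intro tendsto_intros)
  then have "\<forall>\<^sub>F y in at x. C * norm (y - x) < e"
    by (rule order_tendstoD) (use assms in simp)
  then show ?thesis
  proof (rule eventually_mono)
    fix y
    assume "C * norm (y - x) < e"
    then have "C * norm (y - x) * norm (y - x) \<le> e * norm (y - x)"
      by (intro mult_right_mono) auto
    then show "C * (norm (y - x))\<^sup>2 \<le> e * norm (y - x)"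
      by (simp add: power2_eq_square mult.assoc)
  qed
qed

text \<open>The quadratic term is negligible against \<open>e * norm (y - x)\<close> near \<open>x\<close>. Quadratic estimates are what
  the construction of the iterates provides.\<close>

lemma proximal_imp_frechet:
  fixes h :: "'a::euclidean_space \<Rightarrow> ereal"
  assumes hx: "h x = ereal r"
    and prox: "\<forall>\<^sub>F y in at x. ereal (r + v \<bullet> (y - x) - C * (norm (y - x))\<^sup>2) \<le> h y"
  shows "v \<in> frechet_subdiff h x"
  unfolding frechet_subdiff_iff[where h = h and x = x and r = r, OF hx]
proof (intro allI impI)
  fix e :: real
  assume "e > 0"
  from eventually_quadratic_le_linear[OF this, of C x] prox
  show "\<forall>\<^sub>F y in at x. ereal (r + v \<bullet> (y - x) - e * norm (y - x)) \<le> h y"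
  proof eventually_elim
    case (elim y)
    have "ereal (r + v \<bullet> (y - x) - e * norm (y - x))
        \<le> ereal (r + v \<bullet> (y - x) - C * (norm (y - x))\<^sup>2)"
      using elim(1) by simp
    then show ?case
      using elim(2) by (rule order_trans)
  qed
qed

lemma limiting_subdiffI:
  assumes "\<bar>h x\<bar> \<noteq> \<infinity>" "X \<longlonglongrightarrow> x" "(\<lambda>k. h (X k)) \<longlonglongrightarrow> h x"
    and "\<And>k. V k \<in> frechet_subdiff h (X k)" "V \<longlonglongrightarrow> v"
  shows "v \<in> limiting_subdiff h x"
  unfolding limiting_subdiff_def using assms by blast

lemma frechet_imp_limiting:
  assumes "v \<in> frechet_subdiff h x"
  shows "v \<in> limiting_subdiff h x"
proof (rule limiting_subdiffI[where X = "\<lambda>_. x" and V = "\<lambda>_. v"])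
  show "\<bar>h x\<bar> \<noteq> \<infinity>"
    using assms by (simp add: frechet_subdiff_def)
qed (simp_all add: assms)

section \<open>Convex functions with full domain\<close>

text \<open>A convex function lies below its chords, so the local estimate at a point \<open>x + s (y - x)\<close> with
  small \<open>s\<close>, divided by \<open>s\<close>, becomes a global one.\<close>

lemma frechet_subgradient_convex:
  fixes h :: "'a::euclidean_space \<Rightarrow> real"
  assumes conv: "convex_on UNIV h"
    and v: "v \<in> frechet_subdiff (\<lambda>y. ereal (h y)) x"
  shows "h x + v \<bullet> (y - x) \<le> h y"
proof (cases "y = x")
  case False
  let ?n = "norm (y - x)"
  have "h x + v \<bullet> (y - x) \<le> h y + e" if "e > 0" for e
  proof -
    define c where "c = e / ?n"
    have "c > 0"
      using that False by (simp add: c_def)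
    from v have "\<forall>e>0. \<forall>\<^sub>F y in at x. ereal (h x + v \<bullet> (y - x) - e * norm (y - x)) \<le> ereal (h y)"
      by (subst (asm) frechet_subdiff_iff) auto
    with \<open>c > 0\<close> have "\<forall>\<^sub>F y in at x. h x + v \<bullet> (y - x) - c * norm (y - x) \<le> h y"
      by simp
    then obtain d where d: "d > 0"
      and sup: "\<And>z. z \<noteq> x \<Longrightarrow> dist z x < d \<Longrightarrow> h x + v \<bullet> (z - x) - c * norm (z - x) \<le> h z"
      unfolding eventually_at by blast
    define s where "s = min 1 (d / (2 * ?n))"
    have s: "0 < s" "s \<le> 1"
      using d False by (auto simp: s_def)
    have "s * ?n \<le> d / (2 * ?n) * ?n"
      by (intro mult_right_mono) (auto simp: s_def)
    then have sd: "s * ?n < d"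
      using False d by simp
    let ?z = "x + s *\<^sub>R (y - x)"
    have "h x + v \<bullet> (?z - x) - c * norm (?z - x) \<le> h ?z"
      by (rule sup) (use s sd False in \<open>auto simp: dist_norm\<close>)
    also have "h ?z \<le> (1 - s) * h x + s * h y"
      using convex_onD[OF conv, of s x y] s by (simp add: algebra_simps)
    also have "norm (?z - x) = s * ?n"
      using s by simp
    also have "v \<bullet> (?z - x) = s * (v \<bullet> (y - x))"
      by simp
    finally have "s * (v \<bullet> (y - x)) - c * (s * ?n) \<le> s * (h y - h x)"
      by (simp add: right_diff_distrib left_diff_distrib)
    then have "s * (v \<bullet> (y - x) - e) \<le> s * (h y - h x)"
      using False by (simp add: c_def algebra_simps)
    then show ?thesis
      using s(1) by simp
  qed
  then show ?thesis
    by (rule field_le_epsilon)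
qed simp

text \<open>The global affine support passes to the limit; the definition of a limiting subgradient supplies
  the convergence of the function values.\<close>

lemma limiting_subgradient_convex:
  fixes h :: "'a::euclidean_space \<Rightarrow> real"
  assumes conv: "convex_on UNIV h"
    and v: "v \<in> limiting_subdiff (\<lambda>y. ereal (h y)) x"
  shows "h x + v \<bullet> (y - x) \<le> h y"
proof -
  from v obtain X V where X: "X \<longlonglongrightarrow> x" and hX: "(\<lambda>k. h (X k)) \<longlonglongrightarrow> h x"
    and V: "\<And>k. V k \<in> frechet_subdiff (\<lambda>y. ereal (h y)) (X k)" "V \<longlonglongrightarrow> v"
    unfolding limiting_subdiff_def by auto
  have "(\<lambda>k. h (X k) + V k \<bullet> (y - X k)) \<longlonglongrightarrow> h x + v \<bullet> (y - x)"
    by (intro tendsto_intros X hX V)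
  then show ?thesis
    by (rule LIMSEQ_le_const2) (use frechet_subgradient_convex[OF conv V(1)] in auto)
qed

text \<open>Moving a unit step from \<open>x\<close> in the direction of a subgradient \<open>v\<close> raises \<open>f\<close> by at least \<open>norm v\<close>,
  and \<open>f\<close> is bounded on the ball that contains all these points.\<close>

lemma bounded_subgradients_convex:
  fixes f :: "'a::euclidean_space \<Rightarrow> real"
  assumes cont: "continuous_on UNIV f" and X: "bounded X"
    and sub: "\<And>v. v \<in> V \<Longrightarrow> \<exists>x\<in>X. \<forall>y. f x + v \<bullet> (y - x) \<le> f y"
  shows "bounded V"
proof -
  obtain R where R: "\<And>x. x \<in> X \<Longrightarrow> norm x \<le> R"
    using X by (auto simp: bounded_iff)
  have "bounded (f ` cball 0 (R + 1))"
    by (intro compact_imp_bounded compact_continuous_image continuous_on_subset[OF cont]) auto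
  then obtain M where M: "\<And>x. norm x \<le> R + 1 \<Longrightarrow> \<bar>f x\<bar> \<le> M"
    unfolding bounded_iff by fastforce
  have "norm v \<le> 2 * M" if "v \<in> V" for v
  proof -
    obtain x where x: "x \<in> X" and le: "\<And>y. f x + v \<bullet> (y - x) \<le> f y"
      using sub[OF \<open>v \<in> V\<close>] by blast
    have "f x + v \<bullet> sgn v \<le> f (x + sgn v)"
      using le[of "x + sgn v"] by simp
    moreover have "v \<bullet> sgn v = norm v"
      by (cases "v = 0") (simp_all add: sgn_div_norm dot_square_norm power2_eq_square)
    moreover have "norm (x + sgn v) \<le> R + 1"
      using norm_triangle_ineq[of x "sgn v"] R[OF x] by (simp add: norm_sgn split: if_splits)
    ultimately show ?thesis
      using M[of x] M[of "x + sgn v"] R[OF x] by linarith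
  qed
  then show ?thesis
    by (rule boundedI)
qed

text \<open>On the segment from \<open>x\<close> to the unit sphere around \<open>x\<close>, \<open>f\<close> lies below the chord, and its values
  on that sphere are bounded.\<close>

lemma convex_on_imp_calm_above:
  fixes f :: "'a::euclidean_space \<Rightarrow> real"
  assumes conv: "convex_on UNIV f" and cont: "continuous_on UNIV f"
  obtains C where "\<And>y. norm (y - x) \<le> 1 \<Longrightarrow> f y - f x \<le> C * norm (y - x)"
proof -
  have "bounded (f ` cball x 1)"
    by (intro compact_imp_bounded compact_continuous_image continuous_on_subset[OF cont]) auto
  then obtain M where M: "\<And>y. dist x y \<le> 1 \<Longrightarrow> \<bar>f y\<bar> \<le> M"
    unfolding bounded_iff by fastforce
  have "f y - f x \<le> (M - f x) * norm (y - x)" if "norm (y - x) \<le> 1" for y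
  proof -
    let ?s = "norm (y - x)" and ?z = "x + sgn (y - x)"
    have "y = (1 - ?s) *\<^sub>R x + ?s *\<^sub>R ?z"
      by (cases "y = x") (simp_all add: sgn_div_norm algebra_simps)
    then have "f y \<le> (1 - ?s) * f x + ?s * f ?z"
      using convex_onD[OF conv, of ?s x ?z] that by simp
    also have "\<dots> \<le> (1 - ?s) * f x + ?s * M"
      using abs_le_D1[OF M[of ?z]]
      by (intro add_left_mono mult_left_mono) (auto simp: dist_norm norm_sgn split: if_splits)
    finally show ?thesis
      by (simp add: algebra_simps)
  qed
  then show thesis
    by (rule that)
qed

lemma convex_on_l1norm: "convex_on UNIV l1norm"
proof (rule convex_onI)
  fix t :: real and x y :: "real ^ 'n"
  assume t: "0 < t" "t < 1"
  have "\<bar>(1 - t) * x $ i + t * y $ i\<bar> \<le> (1 - t) * \<bar>x $ i\<bar> + t * \<bar>y $ i\<bar>" for i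
    using t abs_triangle_ineq[of "(1 - t) * x $ i" "t * y $ i"] by (simp add: abs_mult)
  then show "l1norm ((1 - t) *\<^sub>R x + t *\<^sub>R y) \<le> (1 - t) * l1norm x + t * l1norm y"
    unfolding l1norm_def sum_distrib_left sum.distrib[symmetric]
    by (intro sum_mono) simp
qed simp

lemma convex_on_norm_diff_power2:
  fixes a :: "'a::real_normed_vector"
  shows "convex_on UNIV (\<lambda>x. (norm (x - a))\<^sup>2)"
proof (rule convex_onI)
  fix t :: real and x y :: 'a
  assume t: "0 < t" "t < 1"
  have "(1 - t) *\<^sub>R x + t *\<^sub>R y - a = (1 - t) *\<^sub>R (x - a) + t *\<^sub>R (y - a)"
    by (simp add: algebra_simps)
  then have "norm ((1 - t) *\<^sub>R x + t *\<^sub>R y - a) \<le> (1 - t) * norm (x - a) + t * norm (y - a)"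
    using t norm_triangle_ineq[of "(1 - t) *\<^sub>R (x - a)" "t *\<^sub>R (y - a)"] by simp
  then have "(norm ((1 - t) *\<^sub>R x + t *\<^sub>R y - a))\<^sup>2 \<le> ((1 - t) * norm (x - a) + t * norm (y - a))\<^sup>2"
    by (intro power_mono) auto
  also have "\<dots> \<le> (1 - t) * (norm (x - a))\<^sup>2 + t * (norm (y - a))\<^sup>2"
    using convex_onD[OF convex_power2, of t "norm (x - a)" "norm (y - a)"] t by simp
  finally show "(norm ((1 - t) *\<^sub>R x + t *\<^sub>R y - a))\<^sup>2
      \<le> (1 - t) * (norm (x - a))\<^sup>2 + t * (norm (y - a))\<^sup>2" .
qed simp

lemma convex_on_affine_inner: "convex_on UNIV (\<lambda>x. c + p \<bullet> x)"
  by (rule convex_onI) (simp_all add: inner_add_right algebra_simps)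

text \<open>Convexity turns the multiplier condition, which is stated with a limiting subdifferential, into
  global minimality of the Lagrangian.\<close>

lemma convex_on_subproblem_lagrangian:
  assumes "0 \<le> \<alpha>" "0 \<le> m" "0 \<le> l"
  shows "convex_on UNIV (\<lambda>u. sub_obj \<alpha> w xt u + m * sub_con q g z l xt u)"
proof -
  define c where "c = m * (q xt - (g - z) \<bullet> xt)"
  define p where "p = m *\<^sub>R (g - z) - (w / norm xt) *\<^sub>R xt"
  have "convex_on UNIV (\<lambda>u. l1norm u + ((c + p \<bullet> u) + (\<alpha> / 2 + m * l / 2) * (norm (u - xt))\<^sup>2))"
    using assms
    by (intro convex_on_add convex_on_cmul convex_on_l1norm convex_on_affine_inner
        convex_on_norm_diff_power2) auto
  also have "(\<lambda>u. l1norm u + ((c + p \<bullet> u) + (\<alpha> / 2 + m * l / 2) * (norm (u - xt))\<^sup>2))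
      = (\<lambda>u. sub_obj \<alpha> w xt u + m * sub_con q g z l xt u)"
    by (simp add: sub_obj_def sub_con_def c_def p_def fun_eq_iff inner_diff_left inner_diff_right
        inner_commute distrib_left right_diff_distrib distrib_right)
  finally show ?thesis .
qed

section \<open>Functions with a quadratic upper support\<close>

text \<open>Along the segment from \<open>x\<close> to \<open>y\<close>, the difference between \<open>f\<close> and the quadratic bound has
  derivative \<open>\<le> 0\<close>, because the gradient at parameter \<open>s\<close> differs from \<open>g x\<close> by at most
  \<open>L * s * norm (y - x)\<close>.\<close>

lemma quadratic_upper_bound_lipschitz_gradient:
  fixes f :: "'a::euclidean_space \<Rightarrow> real"
  assumes grad: "\<And>u. GDERIV f u :> g u"
    and lip: "L-lipschitz_on UNIV g"
  shows "f y \<le> f x + g x \<bullet> (y - x) + L / 2 * (norm (y - x))\<^sup>2"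
proof -
  let ?d = "y - x"
  define \<phi> where "\<phi> s = f (x + s *\<^sub>R ?d) - s * (g x \<bullet> ?d) - L / 2 * s\<^sup>2 * (norm ?d)\<^sup>2" for s
  define \<phi>' where "\<phi>' s = ?d \<bullet> g (x + s *\<^sub>R ?d) - g x \<bullet> ?d - L * s * (norm ?d)\<^sup>2" for s
  have "((\<lambda>s. f (x + s *\<^sub>R ?d)) has_real_derivative ?d \<bullet> g (x + s *\<^sub>R ?d)) (at s)" for s
  proof -
    have "((\<lambda>s. f (x + s *\<^sub>R ?d)) has_derivative (\<lambda>h. (h *\<^sub>R ?d) \<bullet> g (x + s *\<^sub>R ?d))) (at s)"
      by (rule has_derivative_compose[OF _ grad[unfolded gderiv_def]])
        (auto intro!: derivative_eq_intros)
    then show ?thesis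
      by (rule has_derivative_imp_has_field_derivative) simp
  qed
  then have D: "(\<phi> has_real_derivative \<phi>' s) (at s)" for s
    unfolding \<phi>_def \<phi>'_def by (auto intro!: derivative_eq_intros)
  have neg: "\<phi>' s \<le> 0" if "0 \<le> s" for s
  proof -
    have "?d \<bullet> (g (x + s *\<^sub>R ?d) - g x) \<le> norm ?d * norm (g (x + s *\<^sub>R ?d) - g x)"
      by (rule norm_cauchy_schwarz)
    also have "\<dots> \<le> norm ?d * (L * (s * norm ?d))"
      using lipschitz_onD[OF lip, of "x + s *\<^sub>R ?d" x] that
      by (intro mult_left_mono) (simp_all add: dist_norm)
    finally have "?d \<bullet> g (x + s *\<^sub>R ?d) - ?d \<bullet> g x \<le> L * s * (norm ?d)\<^sup>2"
      by (simp add: inner_diff_right power2_eq_square mult_ac)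
    then show ?thesis
      by (simp add: \<phi>'_def inner_commute)
  qed
  have "\<phi> 1 \<le> \<phi> 0"
    by (rule DERIV_nonpos_imp_nonincreasing[of 0 1]) (use D neg in auto)
  then show ?thesis
    by (simp add: \<phi>_def)
qed

text \<open>The Clarke derivative allows difference quotients with a moving base point. Basing them at
  \<open>x - \<tau> w\<close>, with end point \<open>x\<close>, turns an upper estimate of \<open>q\<close> at \<open>x\<close> into a lower estimate of the
  quotient.\<close>

lemma upper_support_imp_clarke:
  fixes q :: "'a::euclidean_space \<Rightarrow> real"
  assumes upper: "\<And>y. q y \<le> q x + v \<bullet> (y - x) + C * (norm (y - x))\<^sup>2"
  shows "v \<in> clarke_subdiff q x"
  unfolding clarke_subdiff_def
proof (intro CollectI allI)
  fix w
  let ?F = "nhds x \<times>\<^sub>F at_right (0::real)"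
  let ?Q = "\<lambda>(y, \<tau>). ereal ((q (y + \<tau> *\<^sub>R w) - q y) / \<tau>)"
  let ?p = "\<lambda>\<tau>::real. (x - \<tau> *\<^sub>R w, \<tau>)"
  have p: "filterlim ?p ?F (at_right 0)"
  proof (rule filterlim_Pair)
    show "((\<lambda>\<tau>. x - \<tau> *\<^sub>R w) \<longlongrightarrow> x) (at_right 0)"
      by (auto intro!: tendsto_eq_intros)
    show "filterlim (\<lambda>\<tau>::real. \<tau>) (at_right 0) (at_right 0)"
      by (rule filterlim_ident)
  qed
  have "((\<lambda>\<tau>. ereal (v \<bullet> w - C * \<tau> * (norm w)\<^sup>2)) \<longlongrightarrow> ereal (v \<bullet> w)) (at_right 0)"
    by (auto intro!: tendsto_eq_intros)
  then have "ereal (v \<bullet> w) = Limsup (at_right 0) (\<lambda>\<tau>. ereal (v \<bullet> w - C * \<tau> * (norm w)\<^sup>2))"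
    by (intro lim_imp_Limsup[symmetric]) simp
  also have "\<dots> \<le> Limsup (at_right 0) (\<lambda>\<tau>. ?Q (?p \<tau>))"
  proof (rule Limsup_mono)
    have "\<forall>\<^sub>F \<tau> in at_right (0::real). \<tau> > 0"
      by (rule eventually_at_right_less)
    then show "\<forall>\<^sub>F \<tau> in at_right 0. ereal (v \<bullet> w - C * \<tau> * (norm w)\<^sup>2) \<le> ?Q (?p \<tau>)"
    proof eventually_elim
      case (elim \<tau>)
      have "q (x - \<tau> *\<^sub>R w) \<le> q x - \<tau> * (v \<bullet> w) + C * (\<tau>\<^sup>2 * (norm w)\<^sup>2)"
        using upper[of "x - \<tau> *\<^sub>R w"] by (simp add: power_mult_distrib)
      then show ?case
        using elim by (simp add: field_simps power2_eq_square)
    qed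
  qed
  also have "\<dots> \<le> Limsup (filtermap ?p (at_right 0)) ?Q"
    by (rule Limsup_filtermap_ge)
  also have "\<dots> \<le> Limsup ?F ?Q"
    unfolding Limsup_def
    by (rule INF_superset_mono) (use p in \<open>auto simp: filterlim_def le_filter_def\<close>)
  finally show "ereal (v \<bullet> w) \<le> Limsup ?F ?Q" .
qed

text \<open>The region below a paraboloid that touches the graph from below contains a ball that touches the
  epigraph from outside; the direction from the contact point to its centre is that of \<open>(w, -1)\<close>.\<close>

lemma proximal_normal_epigraph:
  fixes q :: "'a::euclidean_space \<Rightarrow> real"
  assumes prox: "\<forall>\<^sub>F y in nhds x. q x + w \<bullet> (y - x) - K * (norm (y - x))\<^sup>2 \<le> q y"
    and K: "K \<ge> 0"
  shows "(w, -1) \<in> frechet_subdiff (indicator_ext (epigraph UNIV q)) (x, q x)"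
proof (rule proximal_imp_frechet)
  show "indicator_ext (epigraph UNIV q) (x, q x) = ereal 0"
    by (simp add: indicator_ext_def epigraph_def)
  have "filterlim fst (nhds x) (at (x, q x))"
    using tendsto_fst[OF tendsto_ident_at, of "(x, q x)" UNIV] by simp
  from eventually_compose_filterlim[OF prox this]
  show "\<forall>\<^sub>F p in at (x, q x). ereal (0 + (w, -1) \<bullet> (p - (x, q x)) - K * (norm (p - (x, q x)))\<^sup>2)
      \<le> indicator_ext (epigraph UNIV q) p"
  proof eventually_elim
    case (elim p)
    obtain y r where p: "p = (y, r)"
      by (cases p)
    show ?case
    proof (cases "q y \<le> r")
      case True
      have "(norm (y - x))\<^sup>2 \<le> (norm (p - (x, q x)))\<^sup>2"
        by (simp add: p norm_prod_def)
      then have "K * (norm (y - x))\<^sup>2 \<le> K * (norm (p - (x, q x)))\<^sup>2"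
        using K by (intro mult_left_mono)
      then show ?thesis
        using True elim by (simp add: p indicator_ext_def epigraph_def)
    qed (simp add: p indicator_ext_def epigraph_def)
  qed
qed

lemma frechet_normalD:
  fixes C :: "'a::euclidean_space set"
  assumes "v \<in> frechet_subdiff (indicator_ext C) x" and x: "x \<in> C" and e: "e > 0"
  shows "\<forall>\<^sub>F y in nhds x. y \<in> C \<longrightarrow> v \<bullet> (y - x) \<le> e * norm (y - x)"
proof -
  have "indicator_ext C x = ereal 0"
    using x by (simp add: indicator_ext_def)
  from assms(1)[unfolded frechet_subdiff_iff[where h = "indicator_ext C" and x = x and r = 0, OF this]] e
  have "\<forall>\<^sub>F y in at x. ereal (0 + v \<bullet> (y - x) - e * norm (y - x)) \<le> indicator_ext C y"
    by blast
  then show ?thesis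
    unfolding eventually_at_filter
    by (rule eventually_mono) (auto simp: indicator_ext_def)
qed

text \<open>A non-horizontal limiting normal exists whenever \<open>q\<close> does not fall off faster than linearly at
  \<open>x\<close>. The minimizers of \<open>q u + K (norm (u - x))\<^sup>2\<close> over a small ball have the proximal subgradient
  \<open>- 2 K (y - x)\<close>. Comparison with the value at \<open>x\<close> gives \<open>K * norm (y - x) \<le> \<bar>C\<bar>\<close>: as \<open>K\<close> grows, the
  minimizers tend to \<open>x\<close> while these subgradients stay bounded.\<close>

lemma ex_limiting_normal_epigraph:
  fixes q :: "'a::euclidean_space \<Rightarrow> real"
  assumes cont: "continuous_on UNIV q"
    and calm: "\<forall>\<^sub>F y in nhds x. q x - q y \<le> C * norm (y - x)"
  shows "\<exists>w. (w, -1) \<in> limiting_subdiff (indicator_ext (epigraph UNIV q)) (x, q x)"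
proof -
  obtain d0 where d0: "d0 > 0" "\<And>y. dist y x < d0 \<Longrightarrow> q x - q y \<le> C * norm (y - x)"
    using calm unfolding eventually_nhds_metric by blast
  define d where "d = d0 / 2"
  have d: "d > 0" and calm_d: "\<And>y. y \<in> cball x d \<Longrightarrow> q x - q y \<le> C * norm (y - x)"
    using d0 by (auto simp: d_def dist_commute)
  \<comment> \<open>The summand \<open>\<bar>C\<bar> / d\<close> keeps the minimizers in the interior of the ball.\<close>
  define K where "K k = real k + 1 + \<bar>C\<bar> / d" for k
  have K: "K k > 0" "K k > C / d" for k
  proof -
    have "\<bar>C\<bar> / d \<ge> 0" "\<bar>C\<bar> / d \<ge> C / d"
      using d by (auto intro: divide_right_mono)
    then show "K k > 0" "K k > C / d"
      unfolding K_def by linarith+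
  qed
  have "\<exists>y\<in>cball x d. \<forall>u\<in>cball x d. q y + K k * (norm (y - x))\<^sup>2 \<le> q u + K k * (norm (u - x))\<^sup>2" for k
    by (rule continuous_attains_inf)
      (use d in \<open>auto intro!: continuous_intros continuous_on_subset[OF cont]\<close>)
  then obtain y where y: "\<And>k. y k \<in> cball x d"
    and y_min: "\<And>k u. u \<in> cball x d \<Longrightarrow>
      q (y k) + K k * (norm (y k - x))\<^sup>2 \<le> q u + K k * (norm (u - x))\<^sup>2"
    by metis
  have y_bound: "K k * norm (y k - x) \<le> \<bar>C\<bar>" for k
  proof (cases "y k = x")
    case False
    have "K k * (norm (y k - x))\<^sup>2 \<le> q x - q (y k)"
      using y_min[of x k] d by simp
    also have "\<dots> \<le> C * norm (y k - x)"
      by (rule calm_d[OF y])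
    finally have "K k * norm (y k - x) * norm (y k - x) \<le> C * norm (y k - x)"
      by (simp add: power2_eq_square mult.assoc)
    then show ?thesis
      using False by simp
  qed simp
  define w where "w k = - (2 * K k) *\<^sub>R (y k - x)" for k
  have support: "q (y k) + w k \<bullet> (u - y k) - K k * (norm (u - y k))\<^sup>2 \<le> q u"
    if "u \<in> cball x d" for k u
  proof -
    have "(norm (u - x))\<^sup>2 = (norm (y k - x))\<^sup>2 + 2 * ((y k - x) \<bullet> (u - y k)) + (norm (u - y k))\<^sup>2"
      by (simp add: power2_norm_eq_inner inner_diff_left inner_diff_right inner_commute)
    then have "K k * (norm (u - x))\<^sup>2
        = K k * (norm (y k - x))\<^sup>2 - w k \<bullet> (u - y k) + K k * (norm (u - y k))\<^sup>2"
      by (simp only: w_def inner_scaleR_left) (simp add: distrib_left)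
    with y_min[OF that, of k] show ?thesis
      by simp
  qed
  have "y \<longlonglongrightarrow> x"
  proof -
    have bound: "norm (y k - x) \<le> \<bar>C\<bar> / real (Suc k)" for k
    proof -
      have "real (Suc k) * norm (y k - x) \<le> K k * norm (y k - x)"
        using d by (intro mult_right_mono) (auto simp: K_def)
      with y_bound[of k] have "real (Suc k) * norm (y k - x) \<le> \<bar>C\<bar>"
        by linarith
      then show ?thesis
        by (simp add: pos_le_divide_eq mult.commute)
    qed
    have "(\<lambda>k. \<bar>C\<bar> / real (Suc k)) \<longlonglongrightarrow> 0"
      using LIMSEQ_Suc[OF lim_const_over_n] .
    then have "(\<lambda>k. y k - x) \<longlonglongrightarrow> 0"
      by (rule Lim_null_comparison[rotated]) (intro always_eventually allI bound)
    then show ?thesis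
      by (rule LIM_zero_cancel)
  qed
  have normal: "(w k, -1) \<in> frechet_subdiff (indicator_ext (epigraph UNIV q)) (y k, q (y k))" for k
  proof (rule proximal_normal_epigraph)
    have "norm (y k - x) < d"
    proof (rule ccontr)
      assume "\<not> norm (y k - x) < d"
      then have "K k * d \<le> K k * norm (y k - x)"
        using K(1)[of k] by (intro mult_left_mono) auto
      also have "\<dots> \<le> \<bar>C\<bar>"
        by (rule y_bound)
      finally have "K k \<le> \<bar>C\<bar> / d"
        using d by (simp add: pos_le_divide_eq)
      then show False
        by (simp add: K_def)
    qed
    then have "\<forall>\<^sub>F u in nhds (y k). u \<in> ball x d"
      by (intro eventually_nhds_in_open) (auto simp: dist_norm norm_minus_commute)
    then show "\<forall>\<^sub>F u in nhds (y k). q (y k) + w k \<bullet> (u - y k) - K k * (norm (u - y k))\<^sup>2 \<le> q u"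
      by (rule eventually_mono) (use support in auto)
    show "K k \<ge> 0"
      using K(1)[of k] by simp
  qed
  have "norm (w k) \<le> 2 * \<bar>C\<bar>" for k
    using y_bound[of k] K(1)[of k] by (simp add: w_def)
  then have "bounded (range w)"
    by (auto intro!: boundedI)
  then obtain l r where r: "strict_mono r" "(w \<circ> r) \<longlonglongrightarrow> l"
    using bounded_imp_convergent_subsequence by blast
  have y_r: "(\<lambda>k. y (r k)) \<longlonglongrightarrow> x"
    using LIMSEQ_subseq_LIMSEQ[OF \<open>y \<longlonglongrightarrow> x\<close> r(1)] by (simp add: o_def)
  have q_r: "(\<lambda>k. q (y (r k))) \<longlonglongrightarrow> q x"
    by (rule continuous_on_tendsto_compose[OF cont y_r]) auto
  let ?h = "indicator_ext (epigraph UNIV q)"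
  let ?X = "\<lambda>k. (y (r k), q (y (r k)))" and ?V = "\<lambda>k. (w (r k), -1::real)"
  have "(l, -1) \<in> limiting_subdiff ?h (x, q x)"
  proof (rule limiting_subdiffI)
    show "?X \<longlonglongrightarrow> (x, q x)" "?V \<longlonglongrightarrow> (l, -1)"
      using y_r q_r r(2) by (auto intro!: tendsto_Pair simp: o_def)
    show "(\<lambda>k. ?h (?X k)) \<longlonglongrightarrow> ?h (x, q x)" "\<bar>?h (x, q x)\<bar> \<noteq> \<infinity>"
      by (simp_all add: indicator_ext_def epigraph_def)
    show "?V k \<in> frechet_subdiff ?h (?X k)" for k
      by (rule normal)
  qed
  then show ?thesis ..
qed

text \<open>The upper support places the points \<open>(x + s d, q x + s (v \<bullet> d) + C s\<^sup>2 (norm d)\<^sup>2)\<close> in the epigraph.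
  A Frechet normal \<open>(w, -1)\<close> makes a non-acute angle with them to first order, which for
  \<open>d = w - v\<close> means \<open>(norm (w - v))\<^sup>2 \<le> 0\<close>. Thus a function with both an upper support and a
  Frechet subgradient is differentiable.\<close>

lemma upper_support_eq_frechet_normal:
  fixes q :: "'a::euclidean_space \<Rightarrow> real"
  assumes upper: "\<And>y. q y \<le> q x + v \<bullet> (y - x) + C * (norm (y - x))\<^sup>2"
    and normal: "(w, -1) \<in> frechet_subdiff (indicator_ext (epigraph UNIV q)) (x, q x)"
  shows "w = v"
proof -
  let ?d = "w - v"
  define \<rho> where "\<rho> s = s * (v \<bullet> ?d) + C * s\<^sup>2 * (norm ?d)\<^sup>2" for s :: real
  define p where "p s = (x + s *\<^sub>R ?d, q x + \<rho> s)" for s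
  define N where "N s = norm (?d, v \<bullet> ?d + C * s * (norm ?d)\<^sup>2)" for s
  have "(norm ?d)\<^sup>2 \<le> e * (N 0 + 1)" if "e > 0" for e
  proof -
    have "(x, q x) \<in> epigraph UNIV q"
      by (simp add: epigraph_def)
    from frechet_normalD[OF normal this that]
    have near: "\<forall>\<^sub>F y in nhds (x, q x). y \<in> epigraph UNIV q \<longrightarrow>
        (w, -1) \<bullet> (y - (x, q x)) \<le> e * norm (y - (x, q x))" .
    have "(p \<longlongrightarrow> (x, q x)) (at_right 0)"
      unfolding p_def \<rho>_def by (auto intro!: tendsto_eq_intros)
    from eventually_compose_filterlim[OF near this]
    have ev: "\<forall>\<^sub>F s in at_right 0. p s \<in> epigraph UNIV q \<longrightarrow>
        (w, -1) \<bullet> (p s - (x, q x)) \<le> e * norm (p s - (x, q x))" .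
    have "(N \<longlongrightarrow> N 0) (at_right 0)"
      unfolding N_def by (auto intro!: tendsto_eq_intros)
    then have "\<forall>\<^sub>F s in at_right 0. N s < N 0 + 1"
      by (rule order_tendstoD) simp
    moreover have "((\<lambda>s. (norm ?d)\<^sup>2 - C * s * (norm ?d)\<^sup>2) \<longlongrightarrow> (norm ?d)\<^sup>2) (at_right 0)"
      by (auto intro!: tendsto_eq_intros)
    moreover have "\<forall>\<^sub>F s in at_right (0::real). (norm ?d)\<^sup>2 - C * s * (norm ?d)\<^sup>2 \<le> e * (N 0 + 1)"
      using ev calculation(1) eventually_at_right_less[of "0::real"]
    proof eventually_elim
      case (elim s)
      have "p s \<in> epigraph UNIV q"
        using upper[of "x + s *\<^sub>R ?d"]
        by (simp add: p_def \<rho>_def epigraph_def power_mult_distrib mult.assoc)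
      with elim(1) have "(w, -1) \<bullet> (p s - (x, q x)) \<le> e * norm (p s - (x, q x))"
        by blast
      moreover have eq: "p s - (x, q x) = s *\<^sub>R (?d, v \<bullet> ?d + C * s * (norm ?d)\<^sup>2)"
        by (simp add: p_def \<rho>_def power2_eq_square algebra_simps)
      moreover have "norm (p s - (x, q x)) = s * N s"
        using elim(3) by (simp only: eq norm_scaleR) (simp add: N_def)
      moreover have "(w, -1) \<bullet> (p s - (x, q x)) = s * ((norm ?d)\<^sup>2 - C * s * (norm ?d)\<^sup>2)"
        by (simp only: eq inner_scaleR_right)
          (simp add: power2_norm_eq_inner inner_diff_left inner_diff_right inner_commute)
      ultimately have "s * ((norm ?d)\<^sup>2 - C * s * (norm ?d)\<^sup>2) \<le> s * (e * N s)"
        by (simp add: mult_ac)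
      then have "(norm ?d)\<^sup>2 - C * s * (norm ?d)\<^sup>2 \<le> e * N s"
        using elim(3) by simp
      also have "\<dots> \<le> e * (N 0 + 1)"
        using elim(2) that by (intro mult_left_mono) auto
      finally show ?case .
    qed
    ultimately show ?thesis
      by (intro tendsto_upperbound[of _ _ "at_right (0::real)"]) auto
  qed
  moreover have "N 0 + 1 > 0"
    by (simp add: N_def add_nonneg_pos)
  ultimately have "(norm ?d)\<^sup>2 \<le> 0 + e" if "e > 0" for e
    using that by (metis add_0 divide_pos_pos nonzero_eq_divide_eq less_irrefl)
  then have "(norm ?d)\<^sup>2 \<le> 0"
    by (rule field_le_epsilon)
  then show ?thesis
    by simp
qed

text \<open>Regularity makes the limiting normal of \<open>ex_limiting_normal_epigraph\<close> a Frechet normal, and then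
  it must be \<open>(v, -1)\<close>. Since \<open>q x = 0\<close>, the points \<open>(y, 0)\<close> with \<open>q y \<le> 0\<close> belong to the epigraph and
  differ from \<open>(x, 0)\<close> horizontally, so only \<open>v\<close> contributes to the normal inequality.\<close>

lemma regular_upper_support_normal_sublevel:
  fixes q :: "'a::euclidean_space \<Rightarrow> real"
  assumes cont: "continuous_on UNIV q"
    and calm: "\<forall>\<^sub>F y in nhds x. q x - q y \<le> C * norm (y - x)"
    and reg: "regular_at q x"
    and upper: "\<And>y. q y \<le> q x + v \<bullet> (y - x) + D * (norm (y - x))\<^sup>2"
    and zero: "q x = 0" and e: "e > 0"
  shows "\<forall>\<^sub>F y in nhds x. q y \<le> 0 \<longrightarrow> v \<bullet> (y - x) \<le> e * norm (y - x)"
proof -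
  let ?E = "epigraph UNIV q"
  obtain w where "(w, -1) \<in> limiting_subdiff (indicator_ext ?E) (x, q x)"
    using ex_limiting_normal_epigraph[OF cont calm] by blast
  with reg have w: "(w, -1) \<in> frechet_subdiff (indicator_ext ?E) (x, q x)"
    by (simp add: regular_at_def regular_set_at_def)
  have "w = v"
    by (rule upper_support_eq_frechet_normal[OF upper w])
  with w zero have normal: "(v, -1) \<in> frechet_subdiff (indicator_ext ?E) (x, 0)"
    by simp
  have "(x, 0) \<in> ?E"
    using zero by (simp add: epigraph_def)
  note near = frechet_normalD[OF normal this e]
  have "((\<lambda>y. (y, 0)) \<longlongrightarrow> (x, 0)) (nhds x)"
    by (intro tendsto_intros filterlim_ident)
  from eventually_compose_filterlim[OF near this] show ?thesis
    by (rule eventually_mono) (simp add: epigraph_def norm_prod_def)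
qed

section \<open>Optimality conditions for the ratio of the norms\<close>

text \<open>The subproblem replaces \<open>norm u\<close> by its linearization \<open>(u \<bullet> x) / norm x\<close>. The error is quadratic,
  because \<open>norm u * norm x - u \<bullet> x \<le> (norm (u - x))\<^sup>2 / 2\<close>. So optimality of \<open>x\<close> gives
  \<open>l1norm u \<ge> l1l2 x * norm u - p \<bullet> (u - x) - O((norm (u - x))\<^sup>2)\<close>. Division by \<open>norm u\<close> yields the claim,
  as exchanging \<open>1 / norm u\<close> for \<open>1 / norm x\<close> in the linear term again costs a quadratic error.\<close>

lemma l1l2_proximal_subgradient:
  fixes x :: "real ^ 'n"
  assumes x: "x \<noteq> 0" and D: "D \<ge> 0" "\<alpha> \<ge> 0"
    and opt: "\<And>u. sub_obj \<alpha> (l1l2 x) x x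
      \<le> sub_obj \<alpha> (l1l2 x) x u + p \<bullet> (u - x) + D * (norm (u - x))\<^sup>2"
  shows "\<exists>E. \<forall>\<^sub>F u in nhds x.
    l1l2 x + (- p /\<^sub>R norm x) \<bullet> (u - x) - E * (norm (u - x))\<^sup>2 \<le> l1l2 u"
proof -
  define \<omega> where "\<omega> = l1l2 x"
  have \<omega>: "\<omega> \<ge> 0"
    by (simp add: \<omega>_def l1l2_def l1norm_def sum_nonneg)
  have nx: "norm x > 0"
    using x by simp
  \<comment> \<open>\<open>A\<close> collects the quadratic errors before the division by \<open>norm u\<close>; the second summand of \<open>E\<close>
      accounts for the exchange of \<open>1 / norm u\<close> for \<open>1 / norm x\<close>. Both use \<open>norm u > norm x / 2\<close>.\<close>
  define A where "A = D + \<alpha> / 2 + \<omega> / (2 * norm x)"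
  have A: "A \<ge> 0"
    using D \<omega> by (simp add: A_def)
  define E where "E = A * 2 / norm x + norm p * (2 / (norm x)\<^sup>2)"
  have "((\<lambda>u. norm u) \<longlongrightarrow> norm x) (nhds x)"
    by (intro tendsto_intros filterlim_ident)
  then have "\<forall>\<^sub>F u in nhds x. norm x / 2 < norm u"
    by (rule order_tendstoD) (use nx in simp)
  then have "\<forall>\<^sub>F u in nhds x. l1l2 x + (- p /\<^sub>R norm x) \<bullet> (u - x) - E * (norm (u - x))\<^sup>2 \<le> l1l2 u"
  proof eventually_elim
    case (elim u)
    let ?d = "u - x"
    have nu: "norm u > 0"
      using elim nx by linarith
    have base: "sub_obj \<alpha> \<omega> x x = 0"
      using nx by (simp add: sub_obj_def \<omega>_def l1l2_def dot_square_norm power2_eq_square)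
    have linear: "norm u \<le> (u \<bullet> x) / norm x + (norm ?d)\<^sup>2 / (2 * norm x)"
    proof -
      have "0 \<le> (norm u - norm x)\<^sup>2"
        by simp
      then have "2 * (norm u * norm x) \<le> 2 * (u \<bullet> x) + (norm ?d)\<^sup>2"
        using dot_norm_neg[of u x] by (simp add: power2_diff)
      then show ?thesis
        using nx by (simp add: field_simps)
    qed
    have "\<omega> * norm u \<le> \<omega> * ((u \<bullet> x) / norm x + (norm ?d)\<^sup>2 / (2 * norm x))"
      using linear \<omega> by (rule mult_left_mono)
    then have "\<omega> * norm u - p \<bullet> ?d - A * (norm ?d)\<^sup>2 \<le> l1norm u"
      using opt[of u] base by (simp add: sub_obj_def A_def \<omega>_def[symmetric] algebra_simps)
    then have "(\<omega> * norm u - p \<bullet> ?d - A * (norm ?d)\<^sup>2) / norm u \<le> l1l2 u"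
      unfolding l1l2_def by (rule divide_right_mono) simp
    then have main: "\<omega> - p \<bullet> ?d / norm u - A * (norm ?d)\<^sup>2 / norm u \<le> l1l2 u"
      using nu by (simp add: diff_divide_distrib)
    have inv: "1 / norm u \<le> 2 / norm x"
      using elim nu nx by (simp add: field_simps)
    then have 1: "A * (norm ?d)\<^sup>2 * (1 / norm u) \<le> A * (norm ?d)\<^sup>2 * (2 / norm x)"
      using A by (intro mult_left_mono) auto
    have "1 / norm u - 1 / norm x = (norm x - norm u) * (1 / norm u) * (1 / norm x)"
      using nu nx by (simp add: field_simps)
    then have "\<bar>1 / norm u - 1 / norm x\<bar> = \<bar>norm x - norm u\<bar> * (1 / norm u) * (1 / norm x)"
      by (simp add: abs_mult)
    also have "\<dots> \<le> norm ?d * (2 / norm x) * (1 / norm x)"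
      using inv nx norm_triangle_ineq3[of x u]
      by (intro mult_mono) (auto simp: norm_minus_commute)
    finally have "norm p * norm ?d * \<bar>1 / norm u - 1 / norm x\<bar>
        \<le> norm p * norm ?d * (norm ?d * (2 / norm x) * (1 / norm x))"
      by (intro mult_left_mono) auto
    moreover have "(p \<bullet> ?d) * (1 / norm u - 1 / norm x)
        \<le> norm p * norm ?d * \<bar>1 / norm u - 1 / norm x\<bar>"
    proof -
      have "(p \<bullet> ?d) * (1 / norm u - 1 / norm x) \<le> \<bar>p \<bullet> ?d\<bar> * \<bar>1 / norm u - 1 / norm x\<bar>"
        by (metis abs_ge_self abs_mult)
      also have "\<dots> \<le> norm p * norm ?d * \<bar>1 / norm u - 1 / norm x\<bar>"
        by (intro mult_right_mono Cauchy_Schwarz_ineq2) simp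
      finally show ?thesis .
    qed
    ultimately have 2: "(p \<bullet> ?d) * (1 / norm u - 1 / norm x)
        \<le> norm p * (2 / (norm x)\<^sup>2) * (norm ?d)\<^sup>2"
      by (simp add: power2_eq_square mult_ac)
    have "\<omega> + (- p /\<^sub>R norm x) \<bullet> ?d - E * (norm ?d)\<^sup>2
        \<le> \<omega> - p \<bullet> ?d / norm u - A * (norm ?d)\<^sup>2 / norm u"
      using 1 2 by (simp add: E_def algebra_simps divide_inverse)
    with main show ?case
      by (simp add: \<omega>_def)
  qed
  then show ?thesis ..
qed

text \<open>When \<open>q\<close> is regular, \<open>\<mu> * (v \<bullet> (u - x)) \<le> o(norm (u - x))\<close> on the feasible set, so the linear
  term of the estimate in \<open>prox\<close> can be dropped there at the cost of an \<open>o(norm (u - x))\<close>; this says that \<open>0\<close> is already a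
  Frechet subgradient of the ratio plus the indicator function. If \<open>q x < 0\<close>, then \<open>\<mu> = 0\<close>, and
  there is no linear term.\<close>

lemma clarke_critical_and_stationaryI:
  fixes q :: "real ^ 'n \<Rightarrow> real"
  assumes feas: "q x \<le> 0" and x: "x \<noteq> 0"
    and \<mu>: "\<mu> \<ge> 0" "\<mu> * q x = 0"
    and prox: "\<forall>\<^sub>F u in nhds x.
      l1l2 x + (- (\<mu> *\<^sub>R v)) \<bullet> (u - x) - E * (norm (u - x))\<^sup>2 \<le> l1l2 u"
    and cont: "continuous_on UNIV q"
    and calm: "\<forall>\<^sub>F y in nhds x. q x - q y \<le> C * norm (y - x)"
    and upper: "\<And>y. q y \<le> q x + v \<bullet> (y - x) + D * (norm (y - x))\<^sup>2"
  shows "clarke_critical_point q x" and "regular_at q x \<Longrightarrow> stationary_point q x"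
proof -
  have prox_at: "\<forall>\<^sub>F u in at x.
      l1l2 x + (- (\<mu> *\<^sub>R v)) \<bullet> (u - x) - E * (norm (u - x))\<^sup>2 \<le> l1l2 u"
    using prox by (simp add: eventually_at_filter eventually_mono)
  have "- (\<mu> *\<^sub>R v) \<in> limiting_subdiff (\<lambda>y. ereal (l1l2 y)) x"
    by (rule frechet_imp_limiting, rule proximal_imp_frechet[OF refl]) (use prox_at in simp)
  moreover have "v \<in> clarke_subdiff q x"
    using upper by (rule upper_support_imp_clarke)
  ultimately show "clarke_critical_point q x"
    unfolding clarke_critical_point_def using feas \<mu>
    by (intro conjI exI[of _ \<mu>] bexI[of _ "- (\<mu> *\<^sub>R v)"] bexI[of _ v]) auto
  assume reg: "regular_at q x"
  let ?F = "\<lambda>y. ereal (l1l2 y) + indicator_ext {z. q z \<le> 0} y"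
  have normal: "\<forall>\<^sub>F u in nhds x. q u \<le> 0 \<longrightarrow> \<mu> * (v \<bullet> (u - x)) \<le> e * norm (u - x)"
    if "e > 0" for e
  proof (cases "\<mu> = 0")
    case False
    with \<mu> have "\<mu> > 0" "q x = 0"
      by auto
    have "e / \<mu> > 0"
      using \<open>\<mu> > 0\<close> that by simp
    from regular_upper_support_normal_sublevel[OF cont calm reg upper \<open>q x = 0\<close> this]
    show ?thesis
      by (rule eventually_mono) (use \<open>\<mu> > 0\<close> in \<open>auto simp: field_simps\<close>)
  qed (use that in simp)
  have base: "?F x = ereal (l1l2 x)"
    using feas by (simp add: indicator_ext_def)
  have "0 \<in> frechet_subdiff ?F x"
    unfolding frechet_subdiff_iff[where h = ?F and x = x and r = "l1l2 x", OF base]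
  proof (intro allI impI)
    fix e :: real
    assume e: "e > 0"
    have near: "\<forall>\<^sub>F u in at x. q u \<le> 0 \<longrightarrow> \<mu> * (v \<bullet> (u - x)) \<le> e / 2 * norm (u - x)"
      using normal[of "e / 2"] e by (simp add: eventually_at_filter eventually_mono)
    have "e / 2 > 0"
      using e by simp
    from prox_at near eventually_quadratic_le_linear[OF this, of E x]
    show "\<forall>\<^sub>F u in at x. ereal (l1l2 x + 0 \<bullet> (u - x) - e * norm (u - x)) \<le> ?F u"
    proof eventually_elim
      case (elim u)
      show ?case
      proof (cases "q u \<le> 0")
        case True
        then have "l1l2 x - e * norm (u - x) \<le> l1l2 u"
          using elim by (simp add: field_simps)
        then show ?thesis
          using True by (simp add: indicator_ext_def)
      qed (simp add: indicator_ext_def)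
    qed
  qed
  then show "stationary_point q x"
    unfolding stationary_point_def using feas frechet_imp_limiting by blast
qed

section \<open>Convergence of the algorithm\<close>

locale MBA =
  fixes P1 P2 q :: "real ^ 'n \<Rightarrow> real"
    and gradP1 :: "real ^ 'n \<Rightarrow> real ^ 'n"
    and x \<zeta> :: "nat \<Rightarrow> real ^ 'n"
    and lbar lag :: "nat \<Rightarrow> real"
    and \<alpha> lmin lmax L :: real
  assumes q_def: "\<And>u. q u = P1 u - P2 u"
    and P1_grad: "\<And>u. GDERIV P1 u :> gradP1 u"
    and P1_lipschitz: "L-lipschitz_on UNIV gradP1"
    and P2_convex: "convex_on UNIV P2"
    and P2_continuous: "continuous_on UNIV P2"
    and q_zero: "q 0 > 0"
    and run: "MBA_run q gradP1 P2 \<alpha> lmin lmax x \<zeta> lbar"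
    and multiplier: "\<And>t. lagrange_multiplier (sub_obj \<alpha> (l1l2 (x t)) (x t))
                            (sub_con q (gradP1 (x t)) (\<zeta> t) (lbar t) (x t)) (x (Suc t)) (lag t)"
    and x_bounded: "bounded (range x)"
begin

lemma parameters: "\<alpha> > 0" "0 < lmin" "lmin < lmax"
  using run by (auto simp: MBA_run_def)

lemma L_nonneg: "L \<ge> 0"
  using P1_lipschitz by (rule lipschitz_on_nonneg)

lemma P1_upper: "P1 u \<le> P1 a + gradP1 a \<bullet> (u - a) + L / 2 * (norm (u - a))\<^sup>2"
  by (rule quadratic_upper_bound_lipschitz_gradient[OF P1_grad P1_lipschitz])

lemma continuous_gradP1: "continuous_on UNIV gradP1"
  by (rule lipschitz_on_continuous_on[OF P1_lipschitz])

lemma continuous_q: "continuous_on UNIV q"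
proof -
  have "continuous_on UNIV P1"
    using P1_grad
    by (auto simp: gderiv_def continuous_on_eq_continuous_at intro: has_derivative_continuous)
  then show ?thesis
    unfolding q_def[abs_def] using P2_continuous by (intro continuous_intros)
qed

text \<open>For \<open>P1\<close> the quadratic bound is applied with base point \<open>y\<close>, where the gradient is at most
  \<open>norm (gradP1 a) + L\<close>.\<close>

lemma q_calm:
  obtains C where "\<forall>\<^sub>F y in nhds a. q a - q y \<le> C * norm (y - a)"
proof -
  obtain C where C: "\<And>y. norm (y - a) \<le> 1 \<Longrightarrow> P2 y - P2 a \<le> C * norm (y - a)"
    using convex_on_imp_calm_above[OF P2_convex P2_continuous] by blast
  have "q a - q y \<le> (norm (gradP1 a) + L + L / 2 + C) * norm (y - a)" if y: "norm (y - a) \<le> 1" for y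
  proof -
    have "norm (gradP1 y) \<le> norm (gradP1 a) + L"
    proof -
      have "norm (gradP1 y) \<le> norm (gradP1 a) + norm (gradP1 y - gradP1 a)"
        by (rule norm_triangle_sub)
      also have "norm (gradP1 y - gradP1 a) \<le> L * norm (y - a)"
        using lipschitz_onD[OF P1_lipschitz, of y a] by (simp add: dist_norm)
      also have "\<dots> \<le> L * 1"
        using y L_nonneg by (rule mult_left_mono)
      finally show ?thesis
        by simp
    qed
    then have "gradP1 y \<bullet> (a - y) \<le> (norm (gradP1 a) + L) * norm (y - a)"
      using norm_cauchy_schwarz[of "gradP1 y" "a - y"]
      by (smt (verit) mult_right_mono norm_ge_zero norm_minus_commute)
    moreover have "L / 2 * (norm (a - y))\<^sup>2 \<le> L / 2 * norm (y - a)"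
      using y L_nonneg
      by (intro mult_left_mono) (auto simp: power2_eq_square norm_minus_commute mult_left_le)
    ultimately show ?thesis
      using P1_upper[of a y] C[OF y] by (simp add: q_def distrib_right)
  qed
  moreover have "\<forall>\<^sub>F y in nhds a. norm (y - a) \<le> 1"
    unfolding eventually_nhds_metric by (intro exI[of _ 1]) (auto simp: dist_norm)
  ultimately show thesis
    by (intro that[of "norm (gradP1 a) + L + L / 2 + C"]) (auto elim: eventually_mono)
qed

lemma iterate_feasible: "q (x t) \<le> 0"
proof (cases t)
  case 0
  then show ?thesis
    using run by (simp add: MBA_run_def)
next
  case (Suc s)
  then show ?thesis
    using run unfolding MBA_run_def by metis
qed

lemma feasible_nonzero: "q u \<le> 0 \<Longrightarrow> u \<noteq> 0"
  using q_zero by auto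

lemma P2_subgradient: "P2 (x t) + \<zeta> t \<bullet> (u - x t) \<le> P2 u"
  by (rule limiting_subgradient_convex[OF P2_convex]) (use run in \<open>auto simp: MBA_run_def\<close>)

lemma q_upper: "q u \<le> q (x t) + (gradP1 (x t) - \<zeta> t) \<bullet> (u - x t) + L / 2 * (norm (u - x t))\<^sup>2"
  using P1_upper[of u "x t"] P2_subgradient[of t u] by (simp add: q_def inner_diff_left)

text \<open>If the last doubling was made from \<open>l\<close>, the trial point for \<open>l\<close> was rejected. For \<open>l \<ge> L\<close> the
  constraint of the subproblem dominates \<open>q\<close>, so no rejection is possible; hence \<open>l < L\<close>.\<close>

lemma lbar_bounds: "lmin \<le> lbar t" "lbar t \<le> lmax + 2 * L"
proof -
  obtain l0 k y where l0: "lmin \<le> l0" "l0 \<le> lmax"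
    and y: "\<forall>j\<le>k. is_arg_min (sub_obj \<alpha> (l1l2 (x t)) (x t))
              (\<lambda>u. sub_con q (gradP1 (x t)) (\<zeta> t) (2 ^ j * l0) (x t) u \<le> 0) (y j)"
    and rejected: "\<forall>j<k. q (y j) > 0"
    and lbar: "lbar t = 2 ^ k * l0"
    using run unfolding MBA_run_def by metis
  have "l0 * 1 \<le> l0 * 2 ^ k"
    using l0 parameters by (intro mult_left_mono) auto
  then show "lmin \<le> lbar t"
    using l0 lbar by (simp add: mult.commute)
  show "lbar t \<le> lmax + 2 * L"
  proof (cases k)
    case 0
    then show ?thesis
      using lbar l0 L_nonneg by simp
  next
    case (Suc j)
    have "2 ^ j * l0 \<le> L"
    proof (rule ccontr)
      assume "\<not> 2 ^ j * l0 \<le> L"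
      then have "L / 2 * (norm (y j - x t))\<^sup>2 \<le> 2 ^ j * l0 / 2 * (norm (y j - x t))\<^sup>2"
        by (intro mult_right_mono) auto
      moreover have "sub_con q (gradP1 (x t)) (\<zeta> t) (2 ^ j * l0) (x t) (y j) \<le> 0"
        using y Suc by (auto simp: is_arg_min_def)
      ultimately have "q (y j) \<le> 0"
        using q_upper[of "y j" t] by (simp add: sub_con_def)
      then show False
        using rejected Suc by (simp add: not_le[symmetric])
    qed
    then show ?thesis
      using lbar l0 Suc parameters by simp
  qed
qed

lemma lbar_nonneg: "lbar t \<ge> 0"
  using lbar_bounds(1)[of t] parameters by simp

lemma sub_obj_decrease:
  "sub_obj \<alpha> (l1l2 (x t)) (x t) (x (Suc t)) \<le> sub_obj \<alpha> (l1l2 (x t)) (x t) (x t)"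
proof -
  obtain l where
    "is_arg_min (sub_obj \<alpha> (l1l2 (x t)) (x t))
       (\<lambda>u. sub_con q (gradP1 (x t)) (\<zeta> t) l (x t) u \<le> 0) (x (Suc t))"
    using run unfolding MBA_run_def by (metis order_refl)
  moreover have "sub_con q (gradP1 (x t)) (\<zeta> t) l (x t) (x t) \<le> 0"
    using iterate_feasible by (simp add: sub_con_def)
  ultimately show ?thesis
    by (simp add: is_arg_min_linorder)
qed

text \<open>The objective of the subproblem vanishes at \<open>x t\<close>, so it is \<open>\<le> 0\<close> at \<open>x (Suc t)\<close>; the
  Cauchy-Schwarz inequality and division by \<open>norm (x (Suc t))\<close> give the claim.\<close>

lemma ratio_decrease:
  "l1l2 (x (Suc t)) + \<alpha> / (2 * norm (x (Suc t))) * (norm (x (Suc t) - x t))\<^sup>2 \<le> l1l2 (x t)"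
proof -
  let ?\<omega> = "l1l2 (x t)" and ?y = "x (Suc t)"
  have pos: "norm (x t) > 0" "norm ?y > 0"
    using feasible_nonzero iterate_feasible by auto
  have \<omega>: "?\<omega> \<ge> 0"
    by (simp add: l1l2_def l1norm_def sum_nonneg)
  have "sub_obj \<alpha> ?\<omega> (x t) (x t) = 0"
    using pos by (simp add: sub_obj_def l1l2_def dot_square_norm power2_eq_square)
  then have "l1norm ?y + \<alpha> / 2 * (norm (?y - x t))\<^sup>2 \<le> ?\<omega> / norm (x t) * (?y \<bullet> x t)"
    using sub_obj_decrease[of t] by (simp add: sub_obj_def)
  also have "\<dots> \<le> ?\<omega> / norm (x t) * (norm ?y * norm (x t))"
    using \<omega> by (intro mult_left_mono norm_cauchy_schwarz) auto
  also have "\<dots> = ?\<omega> * norm ?y"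
    using pos by simp
  finally have "(l1norm ?y + \<alpha> / 2 * (norm (?y - x t))\<^sup>2) / norm ?y \<le> ?\<omega>"
    using pos by (simp add: pos_divide_le_eq)
  then show ?thesis
    by (simp add: l1l2_def add_divide_distrib)
qed

lemma steps_vanish: "(\<lambda>t. norm (x (Suc t) - x t)) \<longlonglongrightarrow> 0"
proof -
  obtain R where R: "R > 0" "\<And>t. norm (x t) \<le> R"
    using x_bounded by (auto simp: bounded_pos)
  define c where "c = \<alpha> / (2 * R)"
  have c: "c > 0"
    using parameters R by (simp add: c_def)
  have dec: "c * (norm (x (Suc t) - x t))\<^sup>2 \<le> l1l2 (x t) - l1l2 (x (Suc t))" for t
  proof -
    have "norm (x (Suc t)) > 0"
      using feasible_nonzero iterate_feasible by auto
    then have "c \<le> \<alpha> / (2 * norm (x (Suc t)))"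
      unfolding c_def using parameters R(1) R(2)[of "Suc t"] by (intro divide_left_mono mult_pos_pos) auto
    then have "c * (norm (x (Suc t) - x t))\<^sup>2
        \<le> \<alpha> / (2 * norm (x (Suc t))) * (norm (x (Suc t) - x t))\<^sup>2"
      by (rule mult_right_mono) simp
    then show ?thesis
      using ratio_decrease[of t] by linarith
  qed
  have "decseq (\<lambda>t. l1l2 (x t))"
  proof (rule decseq_SucI)
    fix t
    have "0 \<le> c * (norm (x (Suc t) - x t))\<^sup>2"
      using c by simp
    with dec[of t] show "l1l2 (x (Suc t)) \<le> l1l2 (x t)"
      by linarith
  qed
  moreover have "0 \<le> l1l2 (x t)" for t
    by (simp add: l1l2_def l1norm_def sum_nonneg)
  ultimately obtain w where w: "(\<lambda>t. l1l2 (x t)) \<longlonglongrightarrow> w"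
    using decseq_convergent[of "\<lambda>t. l1l2 (x t)" 0] by blast
  have "(\<lambda>t. (l1l2 (x t) - l1l2 (x (Suc t))) / c) \<longlonglongrightarrow> (w - w) / c"
    using c by (intro tendsto_intros w LIMSEQ_Suc[OF w]) auto
  then have "(\<lambda>t. (l1l2 (x t) - l1l2 (x (Suc t))) / c) \<longlonglongrightarrow> 0"
    by simp
  then have "(\<lambda>t. (norm (x (Suc t) - x t))\<^sup>2) \<longlonglongrightarrow> 0"
    by (rule Lim_null_comparison[rotated])
      (use dec c in \<open>auto simp: pos_le_divide_eq mult.commute\<close>)
  then have "(\<lambda>t. sqrt ((norm (x (Suc t) - x t))\<^sup>2)) \<longlonglongrightarrow> sqrt 0"
    by (rule tendsto_real_sqrt)
  then show ?thesis
    by simp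
qed

lemma bounded_zeta: "bounded (range \<zeta>)"
  by (rule bounded_subgradients_convex[OF P2_continuous x_bounded]) (use P2_subgradient in auto)

lemma lagrangian_minimal:
  "sub_obj \<alpha> (l1l2 (x t)) (x t) (x (Suc t))
   \<le> sub_obj \<alpha> (l1l2 (x t)) (x t) u + lag t * sub_con q (gradP1 (x t)) (\<zeta> t) (lbar t) (x t) u"
proof -
  let ?f = "sub_obj \<alpha> (l1l2 (x t)) (x t)"
  let ?c = "sub_con q (gradP1 (x t)) (\<zeta> t) (lbar t) (x t)"
  have m: "lag t \<ge> 0" "lag t * ?c (x (Suc t)) = 0"
    "0 \<in> limiting_subdiff (\<lambda>y. ereal (?f y + lag t * ?c y)) (x (Suc t))"
    using multiplier[of t] by (auto simp: lagrange_multiplier_def)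
  have "convex_on UNIV (\<lambda>y. ?f y + lag t * ?c y)"
    using parameters lbar_nonneg[of t] m(1) by (intro convex_on_subproblem_lagrangian) auto
  from limiting_subgradient_convex[OF this m(3), of u] m(2) show ?thesis
    by simp
qed

lemma lag_nonneg: "lag t \<ge> 0"
  and complementarity: "lag t * sub_con q (gradP1 (x t)) (\<zeta> t) (lbar t) (x t) (x (Suc t)) = 0"
  using multiplier[of t] by (auto simp: lagrange_multiplier_def)

text \<open>The factors \<open>a k\<close> allow two limits of the same minimality property: the ordinary one and, with
  \<open>a k = 1 / lag (r k)\<close>, the one in which the multipliers are unbounded. The constraint function of
  the limiting subproblem has the value \<open>q xbar\<close> at \<open>xbar\<close>, so the limit of complementarity removes
  it from the last inequality.\<close>

lemma limiting_optimality:
  assumes r: "strict_mono r" and xr: "(\<lambda>k. x (r k)) \<longlonglongrightarrow> xbar"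
    and a: "\<And>k. a k \<ge> 0" "a \<longlonglongrightarrow> A" and b: "(\<lambda>k. a k * lag (r k)) \<longlonglongrightarrow> B"
  obtains z l where "l \<ge> 0"
    and "\<And>u. q u \<le> q xbar + (gradP1 xbar - z) \<bullet> (u - xbar) + L / 2 * (norm (u - xbar))\<^sup>2"
    and "B * q xbar = 0"
    and "\<And>u. A * sub_obj \<alpha> (l1l2 xbar) xbar xbar
      \<le> A * sub_obj \<alpha> (l1l2 xbar) xbar u
        + B * ((gradP1 xbar - z) \<bullet> (u - xbar) + l / 2 * (norm (u - xbar))\<^sup>2)"
proof -
  have "bounded (range (\<lambda>k. lbar (r k)))"
  proof (rule boundedI)
    fix b
    assume "b \<in> range (\<lambda>k. lbar (r k))"
    then obtain k where "b = lbar (r k)"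
      by blast
    then show "norm b \<le> lmax + 2 * L"
      using lbar_bounds(2)[of "r k"] lbar_nonneg[of "r k"] by simp
  qed
  moreover have "bounded (range (\<lambda>k. \<zeta> (r k)))"
    by (rule bounded_subset[OF bounded_zeta]) auto
  ultimately have "bounded (range (\<lambda>k. \<zeta> (r k)) \<times> range (\<lambda>k. lbar (r k)))"
    by (intro bounded_Times)
  then have "bounded (range (\<lambda>k. (\<zeta> (r k), lbar (r k))))"
    by (rule bounded_subset) auto
  then obtain zl s where s: "strict_mono s"
    and zl: "((\<lambda>k. (\<zeta> (r k), lbar (r k))) \<circ> s) \<longlonglongrightarrow> zl"
    using bounded_imp_convergent_subsequence by blast
  obtain z l where "zl = (z, l)"
    by (cases zl)
  define \<rho> where "\<rho> = r \<circ> s"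
  have \<rho>: "strict_mono \<rho>"
    unfolding \<rho>_def using r s by (rule strict_mono_o)
  have z: "(\<lambda>k. \<zeta> (\<rho> k)) \<longlonglongrightarrow> z" and l: "(\<lambda>k. lbar (\<rho> k)) \<longlonglongrightarrow> l"
    using tendsto_fst[OF zl] tendsto_snd[OF zl] \<open>zl = (z, l)\<close> by (simp_all add: o_def \<rho>_def)
  have x0: "(\<lambda>k. x (\<rho> k)) \<longlonglongrightarrow> xbar" and as: "(\<lambda>k. a (s k)) \<longlonglongrightarrow> A"
    and bs: "(\<lambda>k. a (s k) * lag (\<rho> k)) \<longlonglongrightarrow> B"
    using LIMSEQ_subseq_LIMSEQ[OF xr s] LIMSEQ_subseq_LIMSEQ[OF a(2) s]
      LIMSEQ_subseq_LIMSEQ[OF b s] by (simp_all only: o_def \<rho>_def)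
  have "(\<lambda>k. norm (x (Suc (\<rho> k)) - x (\<rho> k))) \<longlonglongrightarrow> 0"
    using LIMSEQ_subseq_LIMSEQ[OF steps_vanish \<rho>] by (simp only: o_def)
  then have "(\<lambda>k. x (Suc (\<rho> k)) - x (\<rho> k)) \<longlonglongrightarrow> 0"
    by (rule tendsto_norm_zero_cancel)
  from tendsto_add[OF this x0] have x1: "(\<lambda>k. x (Suc (\<rho> k))) \<longlonglongrightarrow> xbar"
    by simp
  have q0: "(\<lambda>k. q (x (\<rho> k))) \<longlonglongrightarrow> q xbar"
    by (rule continuous_on_tendsto_compose[OF continuous_q x0]) auto
  have g: "(\<lambda>k. gradP1 (x (\<rho> k))) \<longlonglongrightarrow> gradP1 xbar"
    by (rule continuous_on_tendsto_compose[OF continuous_gradP1 x0]) auto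
  have "q xbar \<le> 0"
    using q0 by (rule LIMSEQ_le_const2) (use iterate_feasible in auto)
  then have xbar: "norm xbar \<noteq> 0"
    using feasible_nonzero by simp
  have obj: "(\<lambda>k. sub_obj \<alpha> (l1l2 (x (\<rho> k))) (x (\<rho> k)) (y k))
      \<longlonglongrightarrow> sub_obj \<alpha> (l1l2 xbar) xbar ybar" if "y \<longlonglongrightarrow> ybar" for y ybar
    unfolding sub_obj_def l1l2_def l1norm_def by (intro tendsto_intros x0 that xbar)
  have con: "(\<lambda>k. sub_con q (gradP1 (x (\<rho> k))) (\<zeta> (\<rho> k)) (lbar (\<rho> k)) (x (\<rho> k)) (y k))
      \<longlonglongrightarrow> sub_con q (gradP1 xbar) z l xbar ybar" if "y \<longlonglongrightarrow> ybar" for y ybar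
    unfolding sub_con_def by (intro tendsto_intros x0 that q0 g z l) auto
  show thesis
  proof (rule that)
    show "l \<ge> 0"
      using l by (rule LIMSEQ_le_const) (use lbar_nonneg in blast)
    show "q u \<le> q xbar + (gradP1 xbar - z) \<bullet> (u - xbar) + L / 2 * (norm (u - xbar))\<^sup>2" for u
    proof (rule LIMSEQ_le_const)
      show "(\<lambda>k. q (x (\<rho> k)) + (gradP1 (x (\<rho> k)) - \<zeta> (\<rho> k)) \<bullet> (u - x (\<rho> k))
            + L / 2 * (norm (u - x (\<rho> k)))\<^sup>2)
          \<longlonglongrightarrow> q xbar + (gradP1 xbar - z) \<bullet> (u - xbar) + L / 2 * (norm (u - xbar))\<^sup>2"
        by (intro tendsto_intros x0 q0 g z)
    qed (use q_upper in blast)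
    have "(\<lambda>k. a (s k) * lag (\<rho> k) * sub_con q (gradP1 (x (\<rho> k))) (\<zeta> (\<rho> k)) (lbar (\<rho> k))
        (x (\<rho> k)) (x (Suc (\<rho> k)))) \<longlonglongrightarrow> B * sub_con q (gradP1 xbar) z l xbar xbar"
      by (intro tendsto_mult bs con x1)
    then have "(\<lambda>_. 0) \<longlonglongrightarrow> B * sub_con q (gradP1 xbar) z l xbar xbar"
      by (simp only: mult.assoc complementarity mult_zero_right)
    then show B0: "B * q xbar = 0"
      by (simp add: LIMSEQ_const_iff sub_con_def)
    show "A * sub_obj \<alpha> (l1l2 xbar) xbar xbar
        \<le> A * sub_obj \<alpha> (l1l2 xbar) xbar u
          + B * ((gradP1 xbar - z) \<bullet> (u - xbar) + l / 2 * (norm (u - xbar))\<^sup>2)" for u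
    proof -
      have "A * sub_obj \<alpha> (l1l2 xbar) xbar xbar
          \<le> A * sub_obj \<alpha> (l1l2 xbar) xbar u + B * sub_con q (gradP1 xbar) z l xbar u"
      proof (rule LIMSEQ_le)
        show "(\<lambda>k. a (s k) * sub_obj \<alpha> (l1l2 (x (\<rho> k))) (x (\<rho> k)) (x (Suc (\<rho> k))))
            \<longlonglongrightarrow> A * sub_obj \<alpha> (l1l2 xbar) xbar xbar"
          by (intro tendsto_mult as obj x1)
        show "(\<lambda>k. a (s k) * sub_obj \<alpha> (l1l2 (x (\<rho> k))) (x (\<rho> k)) u + a (s k) * lag (\<rho> k)
              * sub_con q (gradP1 (x (\<rho> k))) (\<zeta> (\<rho> k)) (lbar (\<rho> k)) (x (\<rho> k)) u)
            \<longlonglongrightarrow> A * sub_obj \<alpha> (l1l2 xbar) xbar u + B * sub_con q (gradP1 xbar) z l xbar u"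
          by (intro tendsto_add tendsto_mult as bs obj con tendsto_const)
        show "\<exists>N. \<forall>k\<ge>N. a (s k) * sub_obj \<alpha> (l1l2 (x (\<rho> k))) (x (\<rho> k)) (x (Suc (\<rho> k)))
          \<le> a (s k) * sub_obj \<alpha> (l1l2 (x (\<rho> k))) (x (\<rho> k)) u + a (s k) * lag (\<rho> k)
              * sub_con q (gradP1 (x (\<rho> k))) (\<zeta> (\<rho> k)) (lbar (\<rho> k)) (x (\<rho> k)) u"
          using mult_left_mono[OF lagrangian_minimal a(1)]
          by (auto simp: distrib_left mult.assoc)
      qed
      then show ?thesis
        using B0 by (simp add: sub_con_def distrib_left)
    qed
  qed
qed

lemma accumulation_feasible:
  assumes "(\<lambda>k. x (r k)) \<longlonglongrightarrow> xbar"
  shows "q xbar \<le> 0"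
proof -
  have "(\<lambda>k. q (x (r k))) \<longlonglongrightarrow> q xbar"
    by (rule continuous_on_tendsto_compose[OF continuous_q assms]) auto
  then show ?thesis
    by (rule LIMSEQ_le_const2) (use iterate_feasible in auto)
qed

text \<open>Dividing the Lagrangian by multipliers that tend to infinity, the objective disappears and \<open>xbar\<close>
  minimizes the limiting constraint function alone. Its linear part \<open>v\<close> is then zero, although it is a
  Clarke subgradient of \<open>q\<close> at a point with \<open>q xbar = 0\<close>.\<close>

lemma bounded_lag:
  assumes GMFCQ: "\<And>u. q u \<le> 0 \<Longrightarrow> GMFCQ_at q u"
  shows "bounded (range lag)"
proof (rule ccontr)
  assume unbounded: "\<not> bounded (range lag)"
  have large: "\<exists>t>n. lag t > real m" for n m
  proof (rule ccontr)
    assume "\<not> ?thesis"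
    then have "lag t \<le> max (Max (lag ` {..n})) (real m)" for t
      by (cases "t \<le> n") (auto simp: not_le le_max_iff_disj)
    then have "bounded (range lag)"
      using lag_nonneg by (intro boundedI[of _ "max (Max (lag ` {..n})) (real m)"]) auto
    with unbounded show False ..
  qed
  have "\<exists>f. \<forall>k. lag (f k) > real k \<and> f k < f (Suc k)"
    by (rule dependent_nat_choice) (use large in blast)+
  then obtain f where f: "\<And>k. lag (f k) > real k" "strict_mono f"
    by (auto simp: strict_mono_Suc_iff)
  have "bounded (range (\<lambda>k. x (f k)))"
    by (rule bounded_subset[OF x_bounded]) auto
  then obtain xbar s where s: "strict_mono s" "((\<lambda>k. x (f k)) \<circ> s) \<longlonglongrightarrow> xbar"
    using bounded_imp_convergent_subsequence by blast
  define r where "r = f \<circ> s"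
  have r: "strict_mono r" "(\<lambda>k. x (r k)) \<longlonglongrightarrow> xbar"
    using strict_mono_o[OF f(2) s(1)] s(2) by (simp_all add: r_def o_def)
  have lag_pos: "lag (r k) > 0" for k
    using f(1)[of "s k"] by (simp add: r_def)
  have "(\<lambda>k. inverse (lag (f k))) \<longlonglongrightarrow> 0"
  proof (rule tendsto_inverse_0_at_top)
    show "filterlim (\<lambda>k. lag (f k)) at_top sequentially"
      by (rule filterlim_at_top_mono[OF filterlim_real_sequentially])
        (use f(1) in \<open>simp add: less_imp_le\<close>)
  qed
  from LIMSEQ_subseq_LIMSEQ[OF this s(1)] have a: "(\<lambda>k. inverse (lag (r k))) \<longlonglongrightarrow> 0"
    by (simp add: o_def r_def)
  have b: "(\<lambda>k. inverse (lag (r k)) * lag (r k)) \<longlonglongrightarrow> 1"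
    using lag_pos by (simp add: less_imp_neq[symmetric])
  obtain z l where l: "l \<ge> 0"
    and upper: "\<And>u. q u \<le> q xbar + (gradP1 xbar - z) \<bullet> (u - xbar) + L / 2 * (norm (u - xbar))\<^sup>2"
    and q0: "1 * q xbar = 0"
    and min: "\<And>u. 0 * sub_obj \<alpha> (l1l2 xbar) xbar xbar
      \<le> 0 * sub_obj \<alpha> (l1l2 xbar) xbar u
        + 1 * ((gradP1 xbar - z) \<bullet> (u - xbar) + l / 2 * (norm (u - xbar))\<^sup>2)"
    by (rule limiting_optimality[OF r _ a b]) (use lag_nonneg in auto)
  let ?v = "gradP1 xbar - z"
  have "?v = 0"
  proof (rule ccontr)
    assume "?v \<noteq> 0"
    \<comment> \<open>A step \<open>- c v\<close> changes the quadratic function by \<open>c (l c / 2 - 1) (norm v)\<^sup>2\<close>, which is negative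
        for this \<open>c\<close>.\<close>
    define c where "c = 1 / (l + 1)"
    have c: "c > 0" "l * c < 1"
      using l by (simp_all add: c_def)
    define N where "N = c * (norm ?v)\<^sup>2"
    have N: "N > 0"
      using c(1) \<open>?v \<noteq> 0\<close> by (simp add: N_def)
    have "0 \<le> ?v \<bullet> ((- c) *\<^sub>R ?v) + l / 2 * (norm ((- c) *\<^sub>R ?v))\<^sup>2"
      using min[of "xbar + (- c) *\<^sub>R ?v"] by (simp only: add_diff_cancel_left') simp
    also have "\<dots> = (c * (norm ?v)\<^sup>2) * (l * c / 2 - 1)"
      unfolding inner_scaleR_right norm_scaleR dot_square_norm power_mult_distrib
      by (simp add: power2_eq_square left_diff_distrib right_diff_distrib)
    finally have "0 \<le> N * (l * c / 2 - 1)"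
      by (simp only: N_def)
    with N have "0 \<le> l * c / 2 - 1"
      by (simp only: zero_le_mult_iff) linarith
    then show False
      using c(2) by simp
  qed
  have "?v \<in> clarke_subdiff q xbar"
    using upper by (rule upper_support_imp_clarke)
  then show False
    using GMFCQ[of xbar] q0 \<open>?v = 0\<close> by (simp add: GMFCQ_at_def)
qed

text \<open>The multiplier of the limit is \<open>B / norm xbar\<close>, where \<open>B\<close> is a limit of the multipliers of the
  subproblems: the subproblem measures \<open>l1norm u - l1l2 xbar * norm u\<close>, up to quadratic
  terms, which is \<open>norm u\<close> times the change of the ratio.\<close>

lemma accumulation_critical:
  assumes lag: "bounded (range lag)" and r0: "strict_mono r0" "(\<lambda>k. x (r0 k)) \<longlonglongrightarrow> xbar"
  shows "clarke_critical_point q xbar" and "regular_at q xbar \<Longrightarrow> stationary_point q xbar"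
proof -
  have "bounded (range (\<lambda>k. lag (r0 k)))"
    by (rule bounded_subset[OF lag]) auto
  then obtain B s where s: "strict_mono s" "((\<lambda>k. lag (r0 k)) \<circ> s) \<longlonglongrightarrow> B"
    using bounded_imp_convergent_subsequence by blast
  define r where "r = r0 \<circ> s"
  have r: "strict_mono r" "(\<lambda>k. x (r k)) \<longlonglongrightarrow> xbar" "(\<lambda>k. 1 * lag (r k)) \<longlonglongrightarrow> B"
    using strict_mono_o[OF r0(1) s(1)] s(2) LIMSEQ_subseq_LIMSEQ[OF r0(2) s(1)]
    by (simp_all add: r_def o_def)
  have B: "B \<ge> 0"
    using r(3) by (rule LIMSEQ_le_const) (use lag_nonneg in auto)
  have feas: "q xbar \<le> 0"
    by (rule accumulation_feasible[OF r(2)])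
  have xbar: "xbar \<noteq> 0"
    by (rule feasible_nonzero[OF feas])
  obtain z l where l: "l \<ge> 0"
    and upper: "\<And>u. q u \<le> q xbar + (gradP1 xbar - z) \<bullet> (u - xbar) + L / 2 * (norm (u - xbar))\<^sup>2"
    and B0: "B * q xbar = 0"
    and min: "\<And>u. 1 * sub_obj \<alpha> (l1l2 xbar) xbar xbar
      \<le> 1 * sub_obj \<alpha> (l1l2 xbar) xbar u
        + B * ((gradP1 xbar - z) \<bullet> (u - xbar) + l / 2 * (norm (u - xbar))\<^sup>2)"
    by (rule limiting_optimality[OF r(1,2) _ tendsto_const r(3)]) auto
  let ?v = "gradP1 xbar - z" and ?\<mu> = "B / norm xbar"
  have "sub_obj \<alpha> (l1l2 xbar) xbar xbar
      \<le> sub_obj \<alpha> (l1l2 xbar) xbar u + (B *\<^sub>R ?v) \<bullet> (u - xbar) + B * l / 2 * (norm (u - xbar))\<^sup>2" for u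
    using min[of u] by (simp add: distrib_left)
  then have E: "\<exists>E. \<forall>\<^sub>F u in nhds xbar. l1l2 xbar + (- (B *\<^sub>R ?v) /\<^sub>R norm xbar) \<bullet> (u - xbar)
      - E * (norm (u - xbar))\<^sup>2 \<le> l1l2 u"
    using B l parameters by (intro l1l2_proximal_subgradient[OF xbar, of "B * l / 2" \<alpha>]) auto
  have scale: "- (B *\<^sub>R ?v) /\<^sub>R norm xbar = - (?\<mu> *\<^sub>R ?v)"
    by (simp add: divide_inverse mult.commute)
  from E[unfolded scale] obtain E where prox: "\<forall>\<^sub>F u in nhds xbar.
      l1l2 xbar + (- (?\<mu> *\<^sub>R ?v)) \<bullet> (u - xbar) - E * (norm (u - xbar))\<^sup>2 \<le> l1l2 u"
    by blast
  obtain C where calm: "\<forall>\<^sub>F y in nhds xbar. q xbar - q y \<le> C * norm (y - xbar)"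
    by (rule q_calm)
  have \<mu>: "?\<mu> \<ge> 0" "?\<mu> * q xbar = 0"
    using B B0 by simp_all
  note result = clarke_critical_and_stationaryI[OF feas xbar \<mu> prox continuous_q calm upper]
  show "clarke_critical_point q xbar"
    by (rule result(1))
  show "regular_at q xbar \<Longrightarrow> stationary_point q xbar"
    by (rule result(2))
qed

end

theorem theorem6p4:
  fixes P1 P2 q :: "real ^ 'n \<Rightarrow> real"
    and gradP1 :: "real ^ 'n \<Rightarrow> real ^ 'n"
    and x \<zeta> :: "nat \<Rightarrow> real ^ 'n"
    and lbar lag :: "nat \<Rightarrow> real"
    and \<alpha> lmin lmax :: real
  assumes q_def: "\<And>u. q u = P1 u - P2 u"
    and P1_grad: "\<And>u. GDERIV P1 u :> gradP1 u"
    and P1_C1: "continuous_on UNIV gradP1"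
    and P1_lipschitz: "\<exists>L. L-lipschitz_on UNIV gradP1"
    and P2_convex: "convex_on UNIV P2"
    and P2_continuous: "continuous_on UNIV P2"
    and feasible: "{u. q u \<le> 0} \<noteq> {}"
    and q_zero: "q 0 > 0"
    and GMFCQ: "\<And>u. q u \<le> 0 \<Longrightarrow> GMFCQ_at q u"
    and run: "MBA_run q gradP1 P2 \<alpha> lmin lmax x \<zeta> lbar"
    and multiplier: "\<And>t. lagrange_multiplier (sub_obj \<alpha> (l1l2 (x t)) (x t))
                            (sub_con q (gradP1 (x t)) (\<zeta> t) (lbar t) (x t)) (x (Suc t)) (lag t)"
    and x_bounded: "bounded (range x)"
  shows "((\<lambda>t. norm (x (Suc t) - x t)) \<longlonglongrightarrow> 0) \<and>
         (bounded (range lag) \<and> bounded (range \<zeta>)) \<and>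
         (\<forall>xbar. (\<exists>r. strict_mono r \<and> (x \<circ> r) \<longlonglongrightarrow> xbar) \<longrightarrow>
            clarke_critical_point q xbar \<and> (regular_at q xbar \<longrightarrow> stationary_point q xbar))"
proof -
  obtain L where "L-lipschitz_on UNIV gradP1"
    using P1_lipschitz by blast
  then interpret MBA P1 P2 q gradP1 x \<zeta> lbar lag \<alpha> lmin lmax L
    using q_def P1_grad P2_convex P2_continuous q_zero run multiplier x_bounded
    by unfold_locales
  have lag: "bounded (range lag)"
    by (rule bounded_lag[OF GMFCQ])
  have "clarke_critical_point q xbar \<and> (regular_at q xbar \<longrightarrow> stationary_point q xbar)"
    if "strict_mono r" "(x \<circ> r) \<longlonglongrightarrow> xbar" for xbar r
    using accumulation_critical[OF lag that(1)] that(2) by (simp add: o_def)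
  then show ?thesis
    using steps_vanish lag bounded_zeta by blast
qed

end
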